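(* For any ordinal $\alpha$, if $G$ and $H$ are groups such that $G\equiv^{\mathrm{bf}}_{1+\alpha}H$, then for any weak modulus $\Omega$ we have $C^*_r(G)\equiv^{\mathrm{bf},\Omega}_\alpha C^*_r(H)$.
   Context: Classical back-and-forth relations. Groups are (discrete) first-order structures in the language of groups (multiplication, inverse, identity). Given structures $M,N$ in the same classical language, finite tuples $\vec a$ from $M$ and $\vec b$ from $N$ of the same length, and an ordinal $\alpha$, define $(M,\vec a)\equiv^{\mathrm{bf}}_\alpha(N,\vec b)$ by recursion. For $\alpha=0$: for every quantifier-free formula $\varphi(\vec x)$, $M\models\varphi(\vec a)\Leftrightarrow N\models\varphi(\vec b)$. For $\alpha>0$: for every $\beta<\alpha$ and every finite tuple $\vec c$ from $M$ (of arbitrary length) there is a finite tuple $\vec d$ from $N$ with $(M,\vec a,\vec c)\equiv^{\mathrm{bf}}_\beta(N,\vec b,\vec d)$, and for every $\beta<\alpha$ and every finite tuple $\vec d$ from $N$ there is a finite tuple $\vec c$ from $M$ with $(M,\vec a,\vec c)\equiv^{\mathrm{bf}}_\beta(N,\vec b,\vec d)$. Write $M\equiv^{\mathrm{bf}}_\alpha N$ if $(M,\varnothing)\equiv^{\mathrm{bf}}_\alpha(N,\varnothing)$. Reduced group C*-algebra. For $g\in G$ let $u_g$ be the unitary on $\ell^2(G)$ with $u_g(\delta_h)=\delta_{gh}$. $\mathbb C[G]$ is identified with the span of the $u_g$ in $\mathcal B(\ell^2(G))$; $C^*_r(G)$ is its closure in the operator norm. A (unital) C*-algebra is viewed in the standard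 way as a many-sorted metric structure: its sorts are the operator norm balls of integer radius, with metric induced by the operator norm (the metric counts as a predicate symbol); the function symbols are the restrictions to these balls of addition, multiplication, scalar multiplication (by each complex scalar) and adjoint, together with the inclusion maps between balls; there are constants $0,1$ in the unit ball. Moduli. A modulus of arity $n$ is a continuous function $\Delta:[0,\infty)^n\to[0,\infty)$ that is non-decreasing, subadditive and vanishes at $0$. A function $f:\prod_{i\le n}X_i\to Y$ between metric spaces obeys (respects) $\Delta$ if $d(f(\vec a),f(\vec b))\le\Delta(d(a_1,b_1),\dots,d(a_n,b_n))$ always. For $f:K\to\mathbb R$ continuous with $K$ a product of compact intervals, $\Delta_f(\delta_1,\dots,\delta_n)=\sup\{|f(\vec x)-f(\vec y)|:|x_i-y_i|\le\delta_i\}$. A weak modulus is a function $\Omega:[0,\infty)^{\mathbb N}\to[0,\infty]$ that is non-decreasing, subadditive, vanishing at zero, lower semicontinuous for the product topology, and continuous in each argument; its truncations are the moduli $\Omega\restriction_n(\delta_1,\dots,\delta_n)=\Omega(\delta_1,\dots,\delta_n,0,0,\dots)$. Basic formulas. Each predicate symbol $P$ of a metric language has a modulus $\Delta_P$ and a compact interval $I_P$ of values; each function symbol $F$ has a modulus $\Delta_F$. Terms in the variables $x_1,x_2,\dots$ carry moduli: the variable $x_i$ has modulus $\Delta_{x_i}(\delta)=\delta_i$, and $F(\tau_1,\dots,\tau_n)$ has modulus $\Delta_F\circ(\Delta_{\tau_1},\dots,\Delta_{\tau_n})$. An atomic formula $P(\tau_1,\dots,\tau_n)$ has modulus $\Delta_P\circ(\Delta_{\tau_1},\dots,\Delta_{\tau_n})$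 and bound $I_P$. A basic formula is $\psi=f(\phi_1,\dots,\phi_k)$ with $\phi_j$ atomic and $f:\prod I_{\phi_j}\to\mathbb R$ continuous; it has modulus $\Delta_f\circ(\Delta_{\phi_1},\dots,\Delta_{\phi_k})$. A basic $\Omega$-formula of arity $n$ is a basic formula depending only on $x_1,\dots,x_n$ that respects $\Omega\restriction_n$ (its modulus is bounded by $\Omega\restriction_n$). Metric back-and-forth. For metric structures $M,N$ in the same language and $\vec a\in M^n$, $\vec b\in N^n$ (corresponding entries in the same sorts), let $r_0^{M,N}(\vec a,\vec b)=\sup_\phi|\phi^M(\vec a)-\phi^N(\vec b)|$ over all basic $\Omega$-formulas $\phi$ of arity $n$, and for $\alpha>0$ $$r_\alpha^{M,N}(\vec a,\vec b)=\max\Bigl\{\sup_{\beta<\alpha}\sup_{\vec c\in M}\inf_{\vec d\in N}r_\beta^{M,N}(\vec a\vec c,\vec b\vec d),\ \sup_{\beta<\alpha}\sup_{\vec d\in N}\inf_{\vec c\in M}r_\beta^{M,N}(\vec a\vec c,\vec b\vec d)\Bigr\},$$ where $\vec c,\vec d$ range over finite tuples (arbitrary length, matching lengths and sorts). Write $(M,\vec a)\equiv^{\mathrm{bf},\Omega}_\alpha(N,\vec b)$ if $r_\alpha^{M,N}(\vec a,\vec b)=0$, and $M\equiv^{\mathrm{bf},\Omega}_\alpha N$ for the case of empty tuples. *)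

theory Defs
  imports "HOL-Analysis.Analysis" "HOL-Algebra.Group" "HOL-Library.Option_ord"
begin

section \<open>Ordinals\<close>

text \<open>
  An ordinal is given by an element \<open>\<alpha>\<close> of a type of class \<^class>\<open>wellorder\<close>; it stands for
  the order type of its set of predecessors \<open>{..<\<alpha>}\<close>, and the element is zero iff this set is empty.
  Recursion on ordinals is recursion along \<open><\<close>.  In the order of \<open>HOL-Library.Option_ord\<close> the type
  \<open>'o option\<close> consists of a new least element \<open>None\<close> followed by a copy of \<open>'o\<close>, so the
  predecessors of \<open>Some \<alpha>\<close> have order type \<open>1 + \<alpha>\<close>.
\<close>

definition one_plus :: "'o::wellorder \<Rightarrow> 'o option" where
  "one_plus \<alpha> = Some \<alpha>"

lemma lessThan_one_plus: "{..<one_plus \<alpha>} = insert None (Some ` {..<\<alpha>})"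
  unfolding one_plus_def by (auto simp: less_option_None_is_Some elim: less_option_None_is_Some
      split: option.splits) (metis imageI lessThan_iff less_option_Some option.exhaust)

lemma one_plus_order:
  "None < Some (\<beta> :: 'o::wellorder)" "Some \<beta> < Some \<gamma> \<longleftrightarrow> \<beta> < \<gamma>"
  by simp_all

definition is_zero :: "'o::wellorder \<Rightarrow> bool" where
  "is_zero \<alpha> \<longleftrightarrow> {..<\<alpha>} = {}"


section \<open>Terms\<close>

text \<open>Variables are indexed from 0; an assignment of the first \<open>n\<close> variables is a list of length \<open>n\<close>.\<close>

datatype 'f trm = Var nat | App 'f "'f trm list"

primrec trm_val :: "('f \<Rightarrow> 'a list \<Rightarrow> 'a) \<Rightarrow> 'a list \<Rightarrow> 'f trm \<Rightarrow> 'a" where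
  "trm_val I as (Var i) = as ! i"
| "trm_val I as (App F ts) = I F (map (trm_val I as) ts)"


section \<open>Classical structures and back-and-forth equivalence\<close>

record ('f, 'p) language =
  fun_syms :: "'f set"
  fun_arity :: "'f \<Rightarrow> nat"
  rel_syms :: "'p set"
  rel_arity :: "'p \<Rightarrow> nat"

record ('f, 'p, 'a) struct =
  universe :: "'a set"
  fun_interp :: "'f \<Rightarrow> 'a list \<Rightarrow> 'a"
  rel_interp :: "'p \<Rightarrow> 'a list \<Rightarrow> bool"

datatype ('f, 'p) qf_formula =
    Falsum
  | Equal "'f trm" "'f trm"
  | Rel 'p "'f trm list"
  | Neg "('f, 'p) qf_formula"
  | Conj "('f, 'p) qf_formula" "('f, 'p) qf_formula"
  | Disj "('f, 'p) qf_formula" "('f, 'p) qf_formula"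

primrec wf_trm :: "('f, 'p) language \<Rightarrow> nat \<Rightarrow> 'f trm \<Rightarrow> bool" where
  "wf_trm L n (Var i) \<longleftrightarrow> i < n"
| "wf_trm L n (App F ts) \<longleftrightarrow>
     F \<in> fun_syms L \<and> length ts = fun_arity L F \<and> list_all (wf_trm L n) ts"

primrec wf_qf :: "('f, 'p) language \<Rightarrow> nat \<Rightarrow> ('f, 'p) qf_formula \<Rightarrow> bool" where
  "wf_qf L n Falsum \<longleftrightarrow> True"
| "wf_qf L n (Equal s t) \<longleftrightarrow> wf_trm L n s \<and> wf_trm L n t"
| "wf_qf L n (Rel P ts) \<longleftrightarrow>
     P \<in> rel_syms L \<and> length ts = rel_arity L P \<and> list_all (wf_trm L n) ts"
| "wf_qf L n (Neg \<phi>) \<longleftrightarrow> wf_qf L n \<phi>"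
| "wf_qf L n (Conj \<phi> \<psi>) \<longleftrightarrow> wf_qf L n \<phi> \<and> wf_qf L n \<psi>"
| "wf_qf L n (Disj \<phi> \<psi>) \<longleftrightarrow> wf_qf L n \<phi> \<and> wf_qf L n \<psi>"

primrec qf_sat :: "('f, 'p, 'a) struct \<Rightarrow> 'a list \<Rightarrow> ('f, 'p) qf_formula \<Rightarrow> bool" where
  "qf_sat M as Falsum \<longleftrightarrow> False"
| "qf_sat M as (Equal s t) \<longleftrightarrow> trm_val (fun_interp M) as s = trm_val (fun_interp M) as t"
| "qf_sat M as (Rel P ts) \<longleftrightarrow> rel_interp M P (map (trm_val (fun_interp M) as) ts)"
| "qf_sat M as (Neg \<phi>) \<longleftrightarrow> \<not> qf_sat M as \<phi>"
| "qf_sat M as (Conj \<phi> \<psi>) \<longleftrightarrow> qf_sat M as \<phi> \<and> qf_sat M as \<psi>"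
| "qf_sat M as (Disj \<phi> \<psi>) \<longleftrightarrow> qf_sat M as \<phi> \<or> qf_sat M as \<psi>"

function bf_equiv ::
  "('f, 'p) language \<Rightarrow> ('f, 'p, 'a) struct \<Rightarrow> ('f, 'p, 'b) struct \<Rightarrow>
   'o::wellorder \<Rightarrow> 'a list \<Rightarrow> 'b list \<Rightarrow> bool" where
  "bf_equiv L M N \<alpha> as bs \<longleftrightarrow>
     (if is_zero \<alpha>
      then \<forall>\<phi>. wf_qf L (length as) \<phi> \<longrightarrow> (qf_sat M as \<phi> \<longleftrightarrow> qf_sat N bs \<phi>)
      else (\<forall>\<beta>\<in>{..<\<alpha>}. \<forall>cs\<in>lists (universe M).
              \<exists>ds\<in>{ds \<in> lists (universe N). length ds = length cs}.
                bf_equiv L M N \<beta> (as @ cs) (bs @ ds)) \<and>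
           (\<forall>\<beta>\<in>{..<\<alpha>}. \<forall>ds\<in>lists (universe N).
              \<exists>cs\<in>{cs \<in> lists (universe M). length cs = length ds}.
                bf_equiv L M N \<beta> (as @ cs) (bs @ ds)))"
  by pat_completeness auto
termination
  by (relation "inv_image {(\<beta>, \<alpha>). \<beta> < \<alpha>} (\<lambda>(L, M, N, \<alpha>, as, bs). \<alpha>)")
     (auto intro: wf_inv_image wellorder_class.wf)

declare bf_equiv.simps [simp del]

definition bf_equiv_struct ::
  "('f, 'p) language \<Rightarrow> 'o::wellorder \<Rightarrow> ('f, 'p, 'a) struct \<Rightarrow> ('f, 'p, 'b) struct \<Rightarrow> bool" where
  "bf_equiv_struct L \<alpha> M N \<longleftrightarrow> bf_equiv L M N \<alpha> [] []"


section \<open>Groups as first-order structures\<close>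

datatype group_sym = Mult | Inv | Unit

text \<open>There are no relation symbols; the type \<open>unit\<close> only serves as a placeholder.\<close>

definition group_language :: "(group_sym, unit) language" where
  "group_language =
     \<lparr>fun_syms = UNIV,
      fun_arity = (\<lambda>F. case F of Mult \<Rightarrow> 2 | Inv \<Rightarrow> 1 | Unit \<Rightarrow> 0),
      rel_syms = {},
      rel_arity = (\<lambda>_. 0)\<rparr>"

fun group_fun :: "('g, 'm) monoid_scheme \<Rightarrow> group_sym \<Rightarrow> 'g list \<Rightarrow> 'g" where
  "group_fun G Mult [x, y] = x \<otimes>\<^bsub>G\<^esub> y"
| "group_fun G Inv [x] = inv\<^bsub>G\<^esub> x"
| "group_fun G Unit [] = \<one>\<^bsub>G\<^esub>"
| "group_fun G _ _ = undefined"

definition group_struct :: "('g, 'm) monoid_scheme \<Rightarrow> (group_sym, unit, 'g) struct" where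
  "group_struct G =
     \<lparr>universe = carrier G, fun_interp = group_fun G, rel_interp = (\<lambda>_ _. False)\<rparr>"


section \<open>Metric structures and metric back-and-forth\<close>

text \<open>
  Moduli of symbols are functions on lists of nonnegative reals, of the length of the arity.
  The metric of each sort is one of the predicate symbols.
\<close>

record ('s, 'f, 'p) metric_language =
  sorts :: "'s set"
  mfun_syms :: "'f set"
  mfun_dom :: "'f \<Rightarrow> 's list"
  mfun_cod :: "'f \<Rightarrow> 's"
  mfun_modulus :: "'f \<Rightarrow> real list \<Rightarrow> real"
  mpred_syms :: "'p set"
  mpred_dom :: "'p \<Rightarrow> 's list"
  mpred_modulus :: "'p \<Rightarrow> real list \<Rightarrow> real"
  mpred_range :: "'p \<Rightarrow> real set"

record ('s, 'f, 'p, 'a) metric_struct =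
  sort_universe :: "'s \<Rightarrow> 'a set"
  mfun_interp :: "'f \<Rightarrow> 'a list \<Rightarrow> 'a"
  mpred_interp :: "'p \<Rightarrow> 'a list \<Rightarrow> real"

text \<open>In a context \<open>\<sigma>\<close>, the variable number \<open>i\<close> has sort \<open>\<sigma> ! i\<close>.\<close>

inductive has_sort :: "('s, 'f, 'p) metric_language \<Rightarrow> 's list \<Rightarrow> 'f trm \<Rightarrow> 's \<Rightarrow> bool"
  for L \<sigma> where
  has_sort_Var: "i < length \<sigma> \<Longrightarrow> has_sort L \<sigma> (Var i) (\<sigma> ! i)"
| has_sort_App: "F \<in> mfun_syms L \<Longrightarrow> list_all2 (has_sort L \<sigma>) ts (mfun_dom L F) \<Longrightarrow>
    has_sort L \<sigma> (App F ts) (mfun_cod L F)"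

primrec trm_modulus :: "('s, 'f, 'p) metric_language \<Rightarrow> 'f trm \<Rightarrow> (nat \<Rightarrow> real) \<Rightarrow> real" where
  "trm_modulus L (Var i) \<delta> = \<delta> i"
| "trm_modulus L (App F ts) \<delta> = mfun_modulus L F (map (\<lambda>t. trm_modulus L t \<delta>) ts)"

datatype ('f, 'p) atomic = Atom (atom_pred: 'p) (atom_args: "'f trm list")

definition wf_atomic ::
  "('s, 'f, 'p) metric_language \<Rightarrow> 's list \<Rightarrow> ('f, 'p) atomic \<Rightarrow> bool" where
  "wf_atomic L \<sigma> \<phi> \<longleftrightarrow> atom_pred \<phi> \<in> mpred_syms L \<and>
     list_all2 (has_sort L \<sigma>) (atom_args \<phi>) (mpred_dom L (atom_pred \<phi>))"

definition atomic_modulus ::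
  "('s, 'f, 'p) metric_language \<Rightarrow> ('f, 'p) atomic \<Rightarrow> (nat \<Rightarrow> real) \<Rightarrow> real" where
  "atomic_modulus L \<phi> \<delta> =
     mpred_modulus L (atom_pred \<phi>) (map (\<lambda>t. trm_modulus L t \<delta>) (atom_args \<phi>))"

definition atomic_val ::
  "('s, 'f, 'p, 'a) metric_struct \<Rightarrow> 'a list \<Rightarrow> ('f, 'p) atomic \<Rightarrow> real" where
  "atomic_val M as \<phi> =
     mpred_interp M (atom_pred \<phi>) (map (trm_val (mfun_interp M) as) (atom_args \<phi>))"

text \<open>
  The basic formula \<open>f(\<phi>\<^sub>0, \<dots>, \<phi>\<^sub>k\<^sub>-\<^sub>1)\<close>.  Points of the box \<open>\<Prod>\<^sub>j I\<^sub>j\<close> are extensional functions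
  on the index set \<open>{..<k}\<close>.
\<close>

datatype ('f, 'p) basic =
  Basic (connective: "(nat \<Rightarrow> real) \<Rightarrow> real") (atoms: "('f, 'p) atomic list")

definition basic_box :: "('s, 'f, 'p) metric_language \<Rightarrow> ('f, 'p) basic \<Rightarrow> (nat \<Rightarrow> real) set" where
  "basic_box L \<psi> =
     (\<Pi>\<^sub>E j\<in>{..<length (atoms \<psi>)}. mpred_range L (atom_pred (atoms \<psi> ! j)))"

definition wf_basic :: "('s, 'f, 'p) metric_language \<Rightarrow> 's list \<Rightarrow> ('f, 'p) basic \<Rightarrow> bool" where
  "wf_basic L \<sigma> \<psi> \<longleftrightarrow>
     list_all (wf_atomic L \<sigma>) (atoms \<psi>) \<and> continuous_on (basic_box L \<psi>) (connective \<psi>)"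

definition basic_val ::
  "('s, 'f, 'p, 'a) metric_struct \<Rightarrow> 'a list \<Rightarrow> ('f, 'p) basic \<Rightarrow> real" where
  "basic_val M as \<psi> =
     connective \<psi> (\<lambda>j\<in>{..<length (atoms \<psi>)}. atomic_val M as (atoms \<psi> ! j))"

text \<open>
  The modulus \<open>\<Delta>\<^sub>f\<close> of \<open>f\<close> on a box \<open>K\<close> with \<open>k\<close> factors; it is finite when \<open>f\<close> is continuous on
  a compact \<open>K\<close>.
\<close>

definition connective_modulus ::
  "nat \<Rightarrow> (nat \<Rightarrow> real) set \<Rightarrow> ((nat \<Rightarrow> real) \<Rightarrow> real) \<Rightarrow> (nat \<Rightarrow> real) \<Rightarrow> ennreal" where
  "connective_modulus k K f \<delta> =
     (SUP (x, y)\<in>{(x, y). x \<in> K \<and> y \<in> K \<and> (\<forall>j<k. \<bar>x j - y j\<bar> \<le> \<delta> j)}. ennreal \<bar>f x - f y\<bar>)"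

definition basic_modulus ::
  "('s, 'f, 'p) metric_language \<Rightarrow> ('f, 'p) basic \<Rightarrow> (nat \<Rightarrow> real) \<Rightarrow> ennreal" where
  "basic_modulus L \<psi> \<delta> =
     connective_modulus (length (atoms \<psi>)) (basic_box L \<psi>) (connective \<psi>)
       (\<lambda>j. atomic_modulus L (atoms \<psi> ! j) \<delta>)"

definition nonneg_seqs :: "(nat \<Rightarrow> real) set" where
  "nonneg_seqs = {\<delta>. \<forall>i. 0 \<le> \<delta> i}"

text \<open>Only the values of \<open>\<Omega>\<close> on nonnegative sequences are relevant.\<close>

definition weak_modulus :: "((nat \<Rightarrow> real) \<Rightarrow> ennreal) \<Rightarrow> bool" where
  "weak_modulus \<Omega> \<longleftrightarrow>
     \<Omega> (\<lambda>_. 0) = 0 \<and>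
     (\<forall>\<delta>\<in>nonneg_seqs. \<forall>\<delta>'\<in>nonneg_seqs. (\<forall>i. \<delta> i \<le> \<delta>' i) \<longrightarrow> \<Omega> \<delta> \<le> \<Omega> \<delta>') \<and>
     (\<forall>\<delta>\<in>nonneg_seqs. \<forall>\<delta>'\<in>nonneg_seqs. \<Omega> (\<lambda>i. \<delta> i + \<delta>' i) \<le> \<Omega> \<delta> + \<Omega> \<delta>') \<and>
     (\<forall>y. openin (top_of_set nonneg_seqs) {\<delta> \<in> nonneg_seqs. y < \<Omega> \<delta>}) \<and>
     (\<forall>\<delta>\<in>nonneg_seqs. \<forall>i. continuous_on {0..} (\<lambda>t. \<Omega> (\<delta>(i := t))))"

definition truncation :: "((nat \<Rightarrow> real) \<Rightarrow> ennreal) \<Rightarrow> nat \<Rightarrow> (nat \<Rightarrow> real) \<Rightarrow> ennreal" where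
  "truncation \<Omega> n \<delta> = \<Omega> (\<lambda>i. if i < n then \<delta> i else 0)"

definition basic_Omega_formulas ::
  "('s, 'f, 'p) metric_language \<Rightarrow> ((nat \<Rightarrow> real) \<Rightarrow> ennreal) \<Rightarrow> 's list \<Rightarrow> ('f, 'p) basic set" where
  "basic_Omega_formulas L \<Omega> \<sigma> =
     {\<psi>. wf_basic L \<sigma> \<psi> \<and>
         (\<forall>\<delta>\<in>nonneg_seqs. basic_modulus L \<psi> \<delta> \<le> truncation \<Omega> (length \<sigma>) \<delta>)}"

definition tuples :: "('s, 'f, 'p, 'a) metric_struct \<Rightarrow> 's list \<Rightarrow> 'a list set" where
  "tuples M \<sigma> = {as. list_all2 (\<lambda>a s. a \<in> sort_universe M s) as \<sigma>}"

text \<open>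
  The pseudo-distance \<open>r\<^sub>\<alpha>\<close> between a tuple of \<open>M\<close> and a tuple of \<open>N\<close>, both of sorts \<open>\<sigma>\<close>.
\<close>

function bf_dist ::
  "('s, 'f, 'p) metric_language \<Rightarrow> ((nat \<Rightarrow> real) \<Rightarrow> ennreal) \<Rightarrow>
   ('s, 'f, 'p, 'a) metric_struct \<Rightarrow> ('s, 'f, 'p, 'b) metric_struct \<Rightarrow>
   'o::wellorder \<Rightarrow> 's list \<Rightarrow> 'a list \<Rightarrow> 'b list \<Rightarrow> ennreal" where
  "bf_dist L \<Omega> M N \<alpha> \<sigma> as bs =
     (if is_zero \<alpha>
      then SUP \<psi>\<in>basic_Omega_formulas L \<Omega> \<sigma>. ennreal \<bar>basic_val M as \<psi> - basic_val N bs \<psi>\<bar>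
      else max
        (SUP \<beta>\<in>{..<\<alpha>}. SUP \<tau>\<in>lists (sorts L). SUP cs\<in>tuples M \<tau>. INF ds\<in>tuples N \<tau>.
           bf_dist L \<Omega> M N \<beta> (\<sigma> @ \<tau>) (as @ cs) (bs @ ds))
        (SUP \<beta>\<in>{..<\<alpha>}. SUP \<tau>\<in>lists (sorts L). SUP ds\<in>tuples N \<tau>. INF cs\<in>tuples M \<tau>.
           bf_dist L \<Omega> M N \<beta> (\<sigma> @ \<tau>) (as @ cs) (bs @ ds)))"
  by pat_completeness auto
termination
  by (relation "inv_image {(\<beta>, \<alpha>). \<beta> < \<alpha>} (\<lambda>(L, \<Omega>, M, N, \<alpha>, \<sigma>, as, bs). \<alpha>)")
     (auto intro: wf_inv_image wellorder_class.wf)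

declare bf_dist.simps [simp del]

definition metric_bf_equiv_struct ::
  "('s, 'f, 'p) metric_language \<Rightarrow> ((nat \<Rightarrow> real) \<Rightarrow> ennreal) \<Rightarrow> 'o::wellorder \<Rightarrow>
   ('s, 'f, 'p, 'a) metric_struct \<Rightarrow> ('s, 'f, 'p, 'b) metric_struct \<Rightarrow> bool" where
  "metric_bf_equiv_struct L \<Omega> \<alpha> M N \<longleftrightarrow> bf_dist L \<Omega> M N \<alpha> [] [] [] = 0"


section \<open>Bounded operators on the Hilbert space of square-summable functions\<close>

text \<open>Elements of \<open>\<ell>\<^sup>2(A)\<close> are functions on the whole type that vanish off \<open>A\<close>.\<close>

definition ell2 :: "'g set \<Rightarrow> ('g \<Rightarrow> complex) set" where
  "ell2 A = {x. (\<forall>h. h \<notin> A \<longrightarrow> x h = 0) \<and> (\<lambda>h. (cmod (x h))\<^sup>2) summable_on A}"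

definition ell2_norm :: "'g set \<Rightarrow> ('g \<Rightarrow> complex) \<Rightarrow> real" where
  "ell2_norm A x = sqrt (\<Sum>\<^sub>\<infinity>h\<in>A. (cmod (x h))\<^sup>2)"

definition ell2_inner :: "'g set \<Rightarrow> ('g \<Rightarrow> complex) \<Rightarrow> ('g \<Rightarrow> complex) \<Rightarrow> complex" where
  "ell2_inner A x y = (\<Sum>\<^sub>\<infinity>h\<in>A. x h * cnj (y h))"

definition ell2_delta :: "'g \<Rightarrow> 'g \<Rightarrow> complex" where
  "ell2_delta h = (\<lambda>k. if k = h then 1 else 0)"

type_synonym 'g operator = "('g \<Rightarrow> complex) \<Rightarrow> 'g \<Rightarrow> complex"

text \<open>
  Operators are extensional functions on \<open>\<ell>\<^sup>2(A)\<close>, so that equality of operators is equality in HOL.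
\<close>

definition bounded_operators :: "'g set \<Rightarrow> 'g operator set" where
  "bounded_operators A =
     {T \<in> ell2 A \<rightarrow>\<^sub>E ell2 A.
        (\<forall>x\<in>ell2 A. \<forall>y\<in>ell2 A. T (\<lambda>h. x h + y h) = (\<lambda>h. T x h + T y h)) \<and>
        (\<forall>c. \<forall>x\<in>ell2 A. T (\<lambda>h. c * x h) = (\<lambda>h. c * T x h)) \<and>
        (\<exists>B. \<forall>x\<in>ell2 A. ell2_norm A (T x) \<le> B * ell2_norm A x)}"

definition op_norm :: "'g set \<Rightarrow> 'g operator \<Rightarrow> real" where
  "op_norm A T = (SUP x\<in>{x \<in> ell2 A. ell2_norm A x \<le> 1}. ell2_norm A (T x))"

definition op_zero :: "'g set \<Rightarrow> 'g operator" where
  "op_zero A = (\<lambda>x\<in>ell2 A. \<lambda>h. 0)"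

definition op_one :: "'g set \<Rightarrow> 'g operator" where
  "op_one A = (\<lambda>x\<in>ell2 A. x)"

definition op_add :: "'g set \<Rightarrow> 'g operator \<Rightarrow> 'g operator \<Rightarrow> 'g operator" where
  "op_add A S T = (\<lambda>x\<in>ell2 A. \<lambda>h. S x h + T x h)"

definition op_diff :: "'g set \<Rightarrow> 'g operator \<Rightarrow> 'g operator \<Rightarrow> 'g operator" where
  "op_diff A S T = (\<lambda>x\<in>ell2 A. \<lambda>h. S x h - T x h)"

definition op_scale :: "'g set \<Rightarrow> complex \<Rightarrow> 'g operator \<Rightarrow> 'g operator" where
  "op_scale A c T = (\<lambda>x\<in>ell2 A. \<lambda>h. c * T x h)"

definition op_mult :: "'g set \<Rightarrow> 'g operator \<Rightarrow> 'g operator \<Rightarrow> 'g operator" where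
  "op_mult A S T = compose (ell2 A) S T"

definition op_adjoint :: "'g set \<Rightarrow> 'g operator \<Rightarrow> 'g operator" where
  "op_adjoint A T =
     (THE S. S \<in> bounded_operators A \<and>
        (\<forall>x\<in>ell2 A. \<forall>y\<in>ell2 A. ell2_inner A (T x) y = ell2_inner A x (S y)))"


section \<open>The reduced group C*-algebra\<close>

text \<open>
  \<open>(u\<^sub>g x)(k) = x(g\<^sup>-\<^sup>1 k)\<close> is the linear isometric extension of \<open>\<delta>\<^sub>h \<mapsto> \<delta>\<^sub>g\<^sub>h\<close>.
\<close>

definition group_unitary :: "('g, 'm) monoid_scheme \<Rightarrow> 'g \<Rightarrow> 'g operator" where
  "group_unitary G g =
     (\<lambda>x\<in>ell2 (carrier G). \<lambda>k. if k \<in> carrier G then x (inv\<^bsub>G\<^esub> g \<otimes>\<^bsub>G\<^esub> k) else 0)"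

lemma ell2_delta_in_ell2: "h \<in> A \<Longrightarrow> ell2_delta h \<in> ell2 A"
proof -
  assume h: "h \<in> A"
  have "(\<lambda>k. (cmod (ell2_delta h k))\<^sup>2) summable_on A \<longleftrightarrow>
        (\<lambda>k. (cmod (ell2_delta h k))\<^sup>2) summable_on {h}"
    by (rule summable_on_cong_neutral) (use h in \<open>auto simp: ell2_delta_def\<close>)
  then show ?thesis using h by (auto simp: ell2_def ell2_delta_def)
qed

lemma group_unitary_delta:
  assumes "group G" "g \<in> carrier G" "h \<in> carrier G"
  shows "group_unitary G g (ell2_delta h) = ell2_delta (g \<otimes>\<^bsub>G\<^esub> h)"
proof -
  interpret group G by fact
  show ?thesis
    using assms(2,3) ell2_delta_in_ell2[OF assms(3)]
    by (auto simp: group_unitary_def ell2_delta_def fun_eq_iff inv_solve_left' m_assoc[symmetric])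
qed

definition group_algebra :: "('g, 'm) monoid_scheme \<Rightarrow> 'g operator set" where
  "group_algebra G =
     {T. \<exists>F c. finite F \<and> F \<subseteq> carrier G \<and>
           T = (\<lambda>x\<in>ell2 (carrier G). \<lambda>k. \<Sum>g\<in>F. c g * group_unitary G g x k)}"

definition reduced_cstar :: "('g, 'm) monoid_scheme \<Rightarrow> 'g operator set" where
  "reduced_cstar G =
     {T \<in> bounded_operators (carrier G).
        \<forall>\<epsilon>>0. \<exists>S\<in>group_algebra G. op_norm (carrier G) (op_diff (carrier G) T S) < \<epsilon>}"


section \<open>C*-algebras as metric structures\<close>

text \<open>
  The sort \<open>n \<ge> 1\<close> is the ball of radius \<open>n\<close>.  \<open>CAdd m n\<close> and \<open>CMult m n\<close> are defined on
  the product of the balls of radii \<open>m\<close> and \<open>n\<close>; \<open>CScale c n\<close>, \<open>CAdj n\<close> and \<open>CIncl n k\<close> are defined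
  on the ball of radius \<open>n\<close>.  Each operation takes values in the smallest ball that is guaranteed to
  contain them, and \<open>CIncl n k\<close> is the inclusion into the ball of radius \<open>k \<ge> n\<close>.
\<close>

datatype cstar_fun =
    CZero
  | COne
  | CAdd nat nat
  | CMult nat nat
  | CScale complex nat
  | CAdj nat
  | CIncl nat nat

datatype cstar_pred = CDist nat

definition scale_radius :: "complex \<Rightarrow> nat \<Rightarrow> nat" where
  "scale_radius c n = max 1 (nat \<lceil>cmod c * real n\<rceil>)"

fun is_cstar_fun :: "cstar_fun \<Rightarrow> bool" where
  "is_cstar_fun CZero \<longleftrightarrow> True"
| "is_cstar_fun COne \<longleftrightarrow> True"
| "is_cstar_fun (CAdd m n) \<longleftrightarrow> 1 \<le> m \<and> 1 \<le> n"
| "is_cstar_fun (CMult m n) \<longleftrightarrow> 1 \<le> m \<and> 1 \<le> n"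
| "is_cstar_fun (CScale c n) \<longleftrightarrow> 1 \<le> n"
| "is_cstar_fun (CAdj n) \<longleftrightarrow> 1 \<le> n"
| "is_cstar_fun (CIncl n k) \<longleftrightarrow> 1 \<le> n \<and> n \<le> k"

fun cstar_fun_dom :: "cstar_fun \<Rightarrow> nat list" where
  "cstar_fun_dom CZero = []"
| "cstar_fun_dom COne = []"
| "cstar_fun_dom (CAdd m n) = [m, n]"
| "cstar_fun_dom (CMult m n) = [m, n]"
| "cstar_fun_dom (CScale c n) = [n]"
| "cstar_fun_dom (CAdj n) = [n]"
| "cstar_fun_dom (CIncl n k) = [n]"

fun cstar_fun_cod :: "cstar_fun \<Rightarrow> nat" where
  "cstar_fun_cod CZero = 1"
| "cstar_fun_cod COne = 1"
| "cstar_fun_cod (CAdd m n) = m + n"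
| "cstar_fun_cod (CMult m n) = m * n"
| "cstar_fun_cod (CScale c n) = scale_radius c n"
| "cstar_fun_cod (CAdj n) = n"
| "cstar_fun_cod (CIncl n k) = k"

text \<open>
  The moduli are the usual Lipschitz estimates; for the product,
  \<open>\<parallel>ab - a'b'\<parallel> \<le> \<parallel>a - a'\<parallel> \<parallel>b\<parallel> + \<parallel>a'\<parallel> \<parallel>b - b'\<parallel> \<le> n \<parallel>a - a'\<parallel> + m \<parallel>b - b'\<parallel>\<close>.
\<close>

fun cstar_fun_modulus :: "cstar_fun \<Rightarrow> real list \<Rightarrow> real" where
  "cstar_fun_modulus CZero [] = 0"
| "cstar_fun_modulus COne [] = 0"
| "cstar_fun_modulus (CAdd m n) [\<delta>, \<epsilon>] = \<delta> + \<epsilon>"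
| "cstar_fun_modulus (CMult m n) [\<delta>, \<epsilon>] = real n * \<delta> + real m * \<epsilon>"
| "cstar_fun_modulus (CScale c n) [\<delta>] = cmod c * \<delta>"
| "cstar_fun_modulus (CAdj n) [\<delta>] = \<delta>"
| "cstar_fun_modulus (CIncl n k) [\<delta>] = \<delta>"
| "cstar_fun_modulus _ _ = undefined"

fun cstar_pred_dom :: "cstar_pred \<Rightarrow> nat list" where
  "cstar_pred_dom (CDist n) = [n, n]"

fun cstar_pred_modulus :: "cstar_pred \<Rightarrow> real list \<Rightarrow> real" where
  "cstar_pred_modulus (CDist n) [\<delta>, \<epsilon>] = \<delta> + \<epsilon>"
| "cstar_pred_modulus _ _ = undefined"

fun cstar_pred_range :: "cstar_pred \<Rightarrow> real set" where
  "cstar_pred_range (CDist n) = {0..2 * real n}"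

definition cstar_language :: "(nat, cstar_fun, cstar_pred) metric_language" where
  "cstar_language =
     \<lparr>sorts = {n. 1 \<le> n},
      mfun_syms = {F. is_cstar_fun F},
      mfun_dom = cstar_fun_dom,
      mfun_cod = cstar_fun_cod,
      mfun_modulus = cstar_fun_modulus,
      mpred_syms = {CDist n | n. 1 \<le> n},
      mpred_dom = cstar_pred_dom,
      mpred_modulus = cstar_pred_modulus,
      mpred_range = cstar_pred_range\<rparr>"

fun operator_fun :: "'g set \<Rightarrow> cstar_fun \<Rightarrow> 'g operator list \<Rightarrow> 'g operator" where
  "operator_fun A CZero [] = op_zero A"
| "operator_fun A COne [] = op_one A"
| "operator_fun A (CAdd m n) [S, T] = op_add A S T"
| "operator_fun A (CMult m n) [S, T] = op_mult A S T"
| "operator_fun A (CScale c n) [T] = op_scale A c T"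
| "operator_fun A (CAdj n) [T] = op_adjoint A T"
| "operator_fun A (CIncl n k) [T] = T"
| "operator_fun A _ _ = undefined"

fun operator_pred :: "'g set \<Rightarrow> cstar_pred \<Rightarrow> 'g operator list \<Rightarrow> real" where
  "operator_pred A (CDist n) [S, T] = op_norm A (op_diff A S T)"
| "operator_pred A _ _ = undefined"

definition reduced_cstar_struct ::
  "('g, 'm) monoid_scheme \<Rightarrow> (nat, cstar_fun, cstar_pred, 'g operator) metric_struct" where
  "reduced_cstar_struct G =
     \<lparr>sort_universe = (\<lambda>n. {T \<in> reduced_cstar G. op_norm (carrier G) T \<le> real n}),
      mfun_interp = operator_fun (carrier G),
      mpred_interp = operator_pred (carrier G)\<rparr>"

end

theory Submission
  imports Defs
begin

text \<open>
  Suppose that tuples \<open>g\<close> of \<open>G\<close> and \<open>h\<close> of \<open>H\<close> are equivalent at level \<open>1 + \<alpha>\<close>, and take finitely many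
  formal combinations \<open>\<Sum> c \<cdot> t\<close> of group terms.  Their values at \<open>g\<close> and at \<open>h\<close> are tuples of elements of
  \<open>\<complex>[G]\<close> and \<open>\<complex>[H]\<close>, and the claim is that these have pseudo-distance \<open>r\<^sub>\<alpha> = 0\<close>.

  The basic fact (\<open>poly_op_norm_eq\<close>) is that a combination has the same operator norm at \<open>g\<close> and at \<open>h\<close> as
  soon as \<open>g\<close> and \<open>h\<close> are equivalent at level 1.  The norm is a supremum over finitely supported
  vectors \<open>x = \<Sum> \<xi> \<cdot> \<delta>\<^sub>c\<close>.  The norms of \<open>x\<close> and of its image depend only on the coincidences between
  the points of the support and their translates, that is, on the quantifier-free type of \<open>g\<close> extended by
  the support; and level 1 provides points of \<open>H\<close> with the same type.  Terms of the language of
  C*-algebras send formal combinations to formal combinations (\<open>trm_val_poly_op\<close>), so all basic formulas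
  agree, which is the case \<open>\<alpha> = 0\<close>.

  For \<open>\<alpha> > 0\<close>, an extension of the tuple in \<open>C\<^sup>*\<^sub>r(G)\<close> is approximated by group algebra elements in the same
  balls (\<open>tuples_approx\<close>).  They are combinations of words over a longer tuple of \<open>G\<close>, and the answer is
  given by the same combinations over a matching tuple of \<open>H\<close>; it has the right norms by the basic fact.
  The error of the approximation is controlled since basic \<open>\<Omega>\<close>-formulas respect \<open>\<Omega>\<close>
  (\<open>basic_val_modulus\<close>) and \<open>\<Omega>\<close> is continuous at zero in finitely many arguments
  (\<open>weak_modulus_small\<close>).  The induction (\<open>bf_dist_le\<close>) carries this error along: for arbitrary tuples the
  pseudo-distance is at most the sum of \<open>\<Omega>\<close> of their distances to the two tuples of combinations.
\<close>


section \<open>Square-summable functions\<close>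

lemma ell2D: "x \<in> ell2 A \<Longrightarrow> h \<notin> A \<Longrightarrow> x h = 0"
  by (auto simp: ell2_def)

lemma ell2_norm_nonneg [simp]: "0 \<le> ell2_norm A x"
  unfolding ell2_norm_def by (simp add: infsum_nonneg)

lemma L2_set_le_ell2_norm:
  assumes "x \<in> ell2 A" "finite F" "F \<subseteq> A"
  shows "L2_set (\<lambda>h. cmod (x h)) F \<le> ell2_norm A x"
  unfolding L2_set_def ell2_norm_def
  by (rule real_sqrt_le_mono, rule finite_sum_le_infsum) (use assms in \<open>auto simp: ell2_def\<close>)

lemma ell2I:
  assumes "\<And>h. h \<notin> A \<Longrightarrow> x h = 0"
    and "\<And>F. finite F \<Longrightarrow> F \<subseteq> A \<Longrightarrow> L2_set (\<lambda>h. cmod (x h)) F \<le> B"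
  shows "x \<in> ell2 A" "ell2_norm A x \<le> B"
proof -
  have B: "0 \<le> B" using assms(2)[of "{}"] by simp
  have le: "(\<Sum>h\<in>F. (cmod (x h))\<^sup>2) \<le> B\<^sup>2" if "finite F" "F \<subseteq> A" for F
    using assms(2)[OF that] unfolding L2_set_def by (rule sqrt_le_D)
  have s: "(\<lambda>h. (cmod (x h))\<^sup>2) summable_on A"
    by (rule nonneg_bounded_partial_sums_imp_summable_on[where C="B\<^sup>2"])
       (auto simp: eventually_finite_subsets_at_top intro!: exI[of _ "{}"] le)
  then show "x \<in> ell2 A" using assms(1) by (auto simp: ell2_def)
  have "(\<Sum>\<^sub>\<infinity>h\<in>A. (cmod (x h))\<^sup>2) \<le> B\<^sup>2" by (rule infsum_le_finite_sums[OF s le])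
  then show "ell2_norm A x \<le> B" unfolding ell2_norm_def
    using B by (simp add: real_le_lsqrt)
qed

lemma cmod_le_ell2_norm: "x \<in> ell2 A \<Longrightarrow> cmod (x h) \<le> ell2_norm A x"
  using L2_set_le_ell2_norm[of x A "{h}"] by (cases "h \<in> A") (auto simp: ell2D)

lemma ell2_norm_eq_0D: "x \<in> ell2 A \<Longrightarrow> ell2_norm A x = 0 \<Longrightarrow> x = (\<lambda>h. 0)"
  using cmod_le_ell2_norm[of x A] by fastforce

lemma
  assumes "x \<in> ell2 A" "y \<in> ell2 A"
  shows ell2_add: "(\<lambda>h. x h + y h) \<in> ell2 A"
    and ell2_norm_triangle: "ell2_norm A (\<lambda>h. x h + y h) \<le> ell2_norm A x + ell2_norm A y"
proof -
  have "L2_set (\<lambda>h. cmod (x h + y h)) F \<le> ell2_norm A x + ell2_norm A y"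
    if "finite F" "F \<subseteq> A" for F
  proof -
    have "L2_set (\<lambda>h. cmod (x h + y h)) F \<le> L2_set (\<lambda>h. cmod (x h) + cmod (y h)) F"
      by (rule L2_set_mono) (auto simp: norm_triangle_ineq)
    also have "\<dots> \<le> L2_set (\<lambda>h. cmod (x h)) F + L2_set (\<lambda>h. cmod (y h)) F"
      by (rule L2_set_triangle_ineq)
    also have "\<dots> \<le> ell2_norm A x + ell2_norm A y"
      by (intro add_mono L2_set_le_ell2_norm assms that)
    finally show ?thesis .
  qed
  with ell2I[of A "\<lambda>h. x h + y h"] assms
  show "(\<lambda>h. x h + y h) \<in> ell2 A"
    "ell2_norm A (\<lambda>h. x h + y h) \<le> ell2_norm A x + ell2_norm A y"
    by (auto simp: ell2D)
qed

lemma ell2_norm_scale: "ell2_norm A (\<lambda>h. c * x h) = cmod c * ell2_norm A x"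
  unfolding ell2_norm_def
  by (simp add: norm_mult power_mult_distrib infsum_cmult_right' real_sqrt_mult)

lemma ell2_scale: "x \<in> ell2 A \<Longrightarrow> (\<lambda>h. c * x h) \<in> ell2 A"
  unfolding ell2_def by (auto simp: norm_mult power_mult_distrib intro: summable_on_cmult_right)

lemma ell2_zero [simp]: "(\<lambda>h. 0) \<in> ell2 A" "ell2_norm A (\<lambda>h. 0) = 0"
  by (auto simp: ell2_def ell2_norm_def)

lemma ell2_diff:
  assumes "x \<in> ell2 A" "y \<in> ell2 A" shows "(\<lambda>h. x h - y h) \<in> ell2 A"
  using ell2_add[OF assms(1) ell2_scale[OF assms(2), of "-1"]] by simp

lemma ell2_sum:
  "(\<And>i. i \<in> I \<Longrightarrow> x i \<in> ell2 A) \<Longrightarrow> (\<lambda>h. \<Sum>i\<in>I. x i h) \<in> ell2 A"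
  by (induction I rule: infinite_finite_induct) (auto intro: ell2_add)

lemma ell2_dominated:
  assumes "y \<in> ell2 A" "\<And>h. cmod (x h) \<le> cmod (y h)"
  shows "x \<in> ell2 A" "ell2_norm A x \<le> ell2_norm A y"
proof -
  have "L2_set (\<lambda>h. cmod (x h)) F \<le> ell2_norm A y" if "finite F" "F \<subseteq> A" for F
    using L2_set_mono[of F "\<lambda>h. cmod (x h)" "\<lambda>h. cmod (y h)"]
      L2_set_le_ell2_norm[OF assms(1) that] assms(2) by fastforce
  moreover have "x h = 0" if "h \<notin> A" for h using assms(2)[of h] ell2D[OF assms(1) that] by simp
  ultimately show "x \<in> ell2 A" "ell2_norm A x \<le> ell2_norm A y"
    using ell2I[of A x "ell2_norm A y"] by auto
qed

text \<open>\<open>restr F x\<close> is the truncation of \<open>x\<close> to \<open>F\<close>: the product of \<open>x\<close> with the indicator of \<open>F\<close>.\<close>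

definition restr :: "'g set \<Rightarrow> ('g \<Rightarrow> complex) \<Rightarrow> 'g \<Rightarrow> complex" where
  "restr F x = (\<lambda>h. if h \<in> F then x h else 0)"

lemma restr_ell2:
  assumes "x \<in> ell2 A" shows "restr F x \<in> ell2 A" "ell2_norm A (restr F x) \<le> ell2_norm A x"
  using ell2_dominated[OF assms, of "restr F x"] by (auto simp: restr_def)

lemma finite_support_norm:
  assumes "finite F" "F \<subseteq> A" "\<And>h. h \<notin> F \<Longrightarrow> x h = 0"
  shows "x \<in> ell2 A" "ell2_norm A x = L2_set (\<lambda>h. cmod (x h)) F"
proof -
  have "(\<lambda>h. (cmod (x h))\<^sup>2) summable_on A \<longleftrightarrow> (\<lambda>h. (cmod (x h))\<^sup>2) summable_on F"
    by (rule summable_on_cong_neutral) (use assms in auto)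
  then show "x \<in> ell2 A" using assms by (auto simp: ell2_def)
  have "(\<Sum>\<^sub>\<infinity>h\<in>A. (cmod (x h))\<^sup>2) = (\<Sum>\<^sub>\<infinity>h\<in>F. (cmod (x h))\<^sup>2)"
    by (rule infsum_cong_neutral) (use assms in auto)
  then show "ell2_norm A x = L2_set (\<lambda>h. cmod (x h)) F"
    using assms(1) by (simp add: ell2_norm_def L2_set_def)
qed

lemma ell2_tail:
  assumes x: "x \<in> ell2 A" and "\<epsilon> > 0"
  obtains F where "finite F" "F \<subseteq> A" "ell2_norm A (\<lambda>h. x h - restr F x h) \<le> \<epsilon>"
proof -
  let ?f = "\<lambda>h. (cmod (x h))\<^sup>2"
  have s: "?f summable_on A" using x by (auto simp: ell2_def)
  obtain F where F: "finite F" "F \<subseteq> A" "dist (sum ?f F) (infsum ?f A) \<le> \<epsilon>\<^sup>2"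
    using infsum_finite_approximation[OF s, of "\<epsilon>\<^sup>2"] \<open>\<epsilon> > 0\<close> by auto
  have "L2_set (\<lambda>h. cmod (x h - restr F x h)) E \<le> \<epsilon>" if E: "finite E" "E \<subseteq> A" for E
  proof -
    have "(\<Sum>h\<in>E. (cmod (x h - restr F x h))\<^sup>2) = sum ?f (E - F)"
      by (rule sum.mono_neutral_cong_right) (use E in \<open>auto simp: restr_def\<close>)
    also have "\<dots> = sum ?f (E \<union> F) - sum ?f F"
      using E F by (simp add: sum_diff[symmetric] Un_Diff)
    also have "\<dots> \<le> infsum ?f A - sum ?f F"
      using finite_sum_le_infsum[OF s, of "E \<union> F"] E F by auto
    also have "\<dots> \<le> \<epsilon>\<^sup>2" using F(3) by (auto simp: dist_real_def)
    finally show ?thesis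
      unfolding L2_set_def using \<open>\<epsilon> > 0\<close> by (simp add: real_le_lsqrt)
  qed
  moreover have "x h - restr F x h = 0" if "h \<notin> A" for h
    using ell2D[OF x that] by (simp add: restr_def)
  ultimately show ?thesis using ell2I(2)[of A "\<lambda>h. x h - restr F x h" \<epsilon>] F that by blast
qed

lemma
  assumes x: "x \<in> ell2 A" and y: "y \<in> ell2 A"
  shows ell2_inner_summable: "(\<lambda>h. x h * cnj (y h)) summable_on A"
    and Cauchy_Schwarz_ell2: "cmod (ell2_inner A x y) \<le> ell2_norm A x * ell2_norm A y"
proof -
  have le: "(\<Sum>h\<in>F. cmod (x h * cnj (y h))) \<le> ell2_norm A x * ell2_norm A y"
    if F: "finite F" "F \<subseteq> A" for F
  proof -
    have "(\<Sum>h\<in>F. cmod (x h * cnj (y h))) = (\<Sum>h\<in>F. \<bar>cmod (x h)\<bar> * \<bar>cmod (y h)\<bar>)"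
      by (simp add: norm_mult)
    also have "\<dots> \<le> L2_set (\<lambda>h. cmod (x h)) F * L2_set (\<lambda>h. cmod (y h)) F"
      by (rule L2_set_mult_ineq)
    also have "\<dots> \<le> ell2_norm A x * ell2_norm A y"
      by (intro mult_mono L2_set_le_ell2_norm x y F) auto
    finally show ?thesis .
  qed
  have s: "(\<lambda>h. cmod (x h * cnj (y h))) summable_on A"
    by (rule nonneg_bounded_partial_sums_imp_summable_on[where C="ell2_norm A x * ell2_norm A y"])
       (auto simp: eventually_finite_subsets_at_top intro!: exI[of _ "{}"] le simp del: norm_mult)
  then show "(\<lambda>h. x h * cnj (y h)) summable_on A" by (rule abs_summable_summable)
  have "cmod (ell2_inner A x y) \<le> (\<Sum>\<^sub>\<infinity>h\<in>A. cmod (x h * cnj (y h)))"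
    unfolding ell2_inner_def by (rule norm_infsum_bound[OF s])
  also have "\<dots> \<le> ell2_norm A x * ell2_norm A y" by (rule infsum_le_finite_sums[OF s le])
  finally show "cmod (ell2_inner A x y) \<le> ell2_norm A x * ell2_norm A y" .
qed

lemma ell2_inner_commute: "ell2_inner A x y = cnj (ell2_inner A y x)"
  unfolding ell2_inner_def infsum_cnj[symmetric] by (simp add: mult.commute)

lemma ell2_inner_add_left:
  assumes "x \<in> ell2 A" "y \<in> ell2 A" "z \<in> ell2 A"
  shows "ell2_inner A (\<lambda>h. x h + y h) z = ell2_inner A x z + ell2_inner A y z"
  unfolding ell2_inner_def using assms
  by (simp add: distrib_right infsum_add ell2_inner_summable)

lemma ell2_inner_scale_left: "ell2_inner A (\<lambda>h. c * x h) z = c * ell2_inner A x z"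
  unfolding ell2_inner_def by (simp add: mult.assoc infsum_cmult_right')

lemma ell2_inner_add_right:
  assumes "x \<in> ell2 A" "y \<in> ell2 A" "z \<in> ell2 A"
  shows "ell2_inner A z (\<lambda>h. x h + y h) = ell2_inner A z x + ell2_inner A z y"
  using ell2_inner_add_left[OF assms] by (subst (1 2 3) ell2_inner_commute) simp

lemma ell2_inner_scale_right: "ell2_inner A z (\<lambda>h. c * x h) = cnj c * ell2_inner A z x"
  by (subst (1 2) ell2_inner_commute) (simp add: ell2_inner_scale_left)

lemma ell2_inner_finite_left:
  assumes "finite F" "F \<subseteq> A" "\<And>h. h \<notin> F \<Longrightarrow> x h = 0"
  shows "ell2_inner A x y = (\<Sum>h\<in>F. x h * cnj (y h))"
proof -
  have "ell2_inner A x y = (\<Sum>\<^sub>\<infinity>h\<in>F. x h * cnj (y h))"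
    unfolding ell2_inner_def by (rule infsum_cong_neutral) (use assms in auto)
  then show ?thesis using assms(1) by simp
qed

lemma ell2_inner_delta_left: "h \<in> A \<Longrightarrow> ell2_inner A (ell2_delta h) y = cnj (y h)"
  by (subst ell2_inner_finite_left[of "{h}"]) (auto simp: ell2_delta_def)

lemma finite_support_eq_sum_delta:
  assumes "finite F" "\<And>h. h \<notin> F \<Longrightarrow> x h = 0"
  shows "x = (\<lambda>k. \<Sum>h\<in>F. x h * ell2_delta h k)"
  by (rule ext) (use assms in \<open>auto simp: ell2_delta_def if_distrib cong: if_cong\<close>)


section \<open>Bounded operators\<close>

lemma bounded_operatorsI:
  assumes "T \<in> extensional (ell2 A)"
    and "\<And>x. x \<in> ell2 A \<Longrightarrow> T x \<in> ell2 A"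
    and "\<And>x y. x \<in> ell2 A \<Longrightarrow> y \<in> ell2 A \<Longrightarrow> T (\<lambda>h. x h + y h) = (\<lambda>h. T x h + T y h)"
    and "\<And>c x. x \<in> ell2 A \<Longrightarrow> T (\<lambda>h. c * x h) = (\<lambda>h. c * T x h)"
    and "\<And>x. x \<in> ell2 A \<Longrightarrow> ell2_norm A (T x) \<le> B * ell2_norm A x"
  shows "T \<in> bounded_operators A"
  unfolding bounded_operators_def using assms by (auto simp: PiE_def intro!: exI[of _ B])

lemma
  assumes "T \<in> bounded_operators A"
  shows bounded_operators_ext: "T \<in> extensional (ell2 A)"
    and bounded_operators_ell2: "x \<in> ell2 A \<Longrightarrow> T x \<in> ell2 A"
    and bounded_operators_add:
      "x \<in> ell2 A \<Longrightarrow> y \<in> ell2 A \<Longrightarrow> T (\<lambda>h. x h + y h) = (\<lambda>h. T x h + T y h)"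
    and bounded_operators_scale: "x \<in> ell2 A \<Longrightarrow> T (\<lambda>h. c * x h) = (\<lambda>h. c * T x h)"
  using assms unfolding bounded_operators_def by (auto simp: PiE_def)

lemma bounded_operators_zero: "T \<in> bounded_operators A \<Longrightarrow> T (\<lambda>h. 0) = (\<lambda>h. 0)"
  using bounded_operators_scale[of T A "\<lambda>h. 0" 0] by simp

lemma bounded_operators_diff:
  assumes "T \<in> bounded_operators A" "x \<in> ell2 A" "y \<in> ell2 A"
  shows "T (\<lambda>h. x h - y h) = (\<lambda>h. T x h - T y h)"
  using bounded_operators_add[OF assms(1,2) ell2_scale[OF assms(3), of "-1"]]
    bounded_operators_scale[OF assms(1,3), of "-1"] by simp

lemma bounded_operators_sum:
  assumes T: "T \<in> bounded_operators A" and "finite I" and x: "\<And>i. i \<in> I \<Longrightarrow> x i \<in> ell2 A"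
  shows "T (\<lambda>h. \<Sum>i\<in>I. c i * x i h) = (\<lambda>h. \<Sum>i\<in>I. c i * T (x i) h)"
  using \<open>finite I\<close> x
proof (induction I rule: finite_induct)
  case empty
  then show ?case by (simp add: bounded_operators_zero[OF T])
next
  case (insert i I)
  have "T (\<lambda>h. c i * x i h + (\<Sum>i\<in>I. c i * x i h))
      = (\<lambda>h. T (\<lambda>h. c i * x i h) h + T (\<lambda>h. \<Sum>i\<in>I. c i * x i h) h)"
    by (rule bounded_operators_add[OF T])
       (use insert.prems in \<open>auto intro!: ell2_sum ell2_scale\<close>)
  then show ?case using insert by (simp add: bounded_operators_scale[OF T])
qed

lemma bounded_operators_eqI:
  assumes "S \<in> bounded_operators A" "T \<in> bounded_operators A"
    and "\<And>x h. x \<in> ell2 A \<Longrightarrow> h \<in> A \<Longrightarrow> S x h = T x h"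
  shows "S = T"
proof (rule extensionalityI[OF bounded_operators_ext[OF assms(1)] bounded_operators_ext[OF assms(2)]])
  fix x assume x: "x \<in> ell2 A"
  show "S x = T x"
  proof
    fix h show "S x h = T x h"
      using assms(3)[OF x, of h] bounded_operators_ell2[OF assms(1) x]
        bounded_operators_ell2[OF assms(2) x] by (cases "h \<in> A") (auto simp: ell2D)
  qed
qed

lemma op_norm_bdd:
  assumes "T \<in> bounded_operators A"
  shows "bdd_above ((\<lambda>x. ell2_norm A (T x)) ` {x \<in> ell2 A. ell2_norm A x \<le> 1})"
proof -
  obtain B where B: "\<And>x. x \<in> ell2 A \<Longrightarrow> ell2_norm A (T x) \<le> B * ell2_norm A x"
    using assms unfolding bounded_operators_def by blast
  have "ell2_norm A (T x) \<le> \<bar>B\<bar>" if "x \<in> ell2 A" "ell2_norm A x \<le> 1" for x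
  proof -
    have "ell2_norm A (T x) \<le> B * ell2_norm A x" using B that by auto
    also have "\<dots> \<le> \<bar>B\<bar> * ell2_norm A x" by (intro mult_right_mono) auto
    also have "\<dots> \<le> \<bar>B\<bar> * 1" by (intro mult_left_mono that) auto
    finally show ?thesis by simp
  qed
  then show ?thesis by (auto intro!: bdd_aboveI[where M="\<bar>B\<bar>"])
qed

lemma op_norm_nonneg: "T \<in> bounded_operators A \<Longrightarrow> 0 \<le> op_norm A T"
  unfolding op_norm_def
  by (rule cSUP_upper2[OF op_norm_bdd, of _ _ "\<lambda>h. 0"]) auto

lemma op_norm_bound:
  assumes T: "T \<in> bounded_operators A" and x: "x \<in> ell2 A"
  shows "ell2_norm A (T x) \<le> op_norm A T * ell2_norm A x"
proof (cases "ell2_norm A x = 0")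
  case True
  then show ?thesis using ell2_norm_eq_0D[OF x] bounded_operators_zero[OF T] by simp
next
  case False
  then have pos: "ell2_norm A x > 0" using ell2_norm_nonneg[of A x] by linarith
  let ?c = "complex_of_real (1 / ell2_norm A x)"
  have "ell2_norm A (T (\<lambda>h. ?c * x h)) \<le> op_norm A T"
    unfolding op_norm_def using pos
    by (intro cSUP_upper op_norm_bdd T CollectI conjI ell2_scale[OF x])
       (simp add: ell2_norm_scale del: of_real_divide)
  then show ?thesis
    using pos unfolding bounded_operators_scale[OF T x] ell2_norm_scale norm_of_real
    by (simp add: field_simps)
qed

lemma op_norm_le:
  assumes "0 \<le> B" "\<And>x. x \<in> ell2 A \<Longrightarrow> ell2_norm A (T x) \<le> B * ell2_norm A x"
  shows "op_norm A T \<le> B"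
  unfolding op_norm_def
proof (rule cSUP_least)
  show "{x \<in> ell2 A. ell2_norm A x \<le> 1} \<noteq> {}" by (auto intro!: exI[of _ "\<lambda>h. 0"])
next
  fix x assume "x \<in> {x \<in> ell2 A. ell2_norm A x \<le> 1}"
  then have "ell2_norm A (T x) \<le> B * ell2_norm A x" "B * ell2_norm A x \<le> B * 1"
    using assms by (blast, intro mult_left_mono) auto
  then show "ell2_norm A (T x) \<le> B" by simp
qed

lemma
  shows op_zero_bounded: "op_zero A \<in> bounded_operators A"
    and op_norm_zero: "op_norm A (op_zero A) = 0"
proof -
  show *: "op_zero A \<in> bounded_operators A"
    by (rule bounded_operatorsI[where B=0]) (auto simp: op_zero_def ell2_add ell2_scale)
  have "op_norm A (op_zero A) \<le> 0" by (rule op_norm_le) (auto simp: op_zero_def)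
  then show "op_norm A (op_zero A) = 0" using op_norm_nonneg[OF *] by simp
qed

lemma
  shows op_one_bounded: "op_one A \<in> bounded_operators A"
    and op_norm_one: "op_norm A (op_one A) \<le> 1"
  by (rule bounded_operatorsI[where B=1] op_norm_le; auto simp: op_one_def ell2_add ell2_scale)+

lemma
  assumes S: "S \<in> bounded_operators A" and T: "T \<in> bounded_operators A"
  shows op_add_bounded: "op_add A S T \<in> bounded_operators A"
    and op_norm_add: "op_norm A (op_add A S T) \<le> op_norm A S + op_norm A T"
proof -
  have bound: "ell2_norm A (op_add A S T x) \<le> (op_norm A S + op_norm A T) * ell2_norm A x"
    if x: "x \<in> ell2 A" for x
    using ell2_norm_triangle[OF bounded_operators_ell2[OF S x] bounded_operators_ell2[OF T x]]
      op_norm_bound[OF S x] op_norm_bound[OF T x] x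
    by (simp add: op_add_def distrib_right)
  show "op_add A S T \<in> bounded_operators A"
    by (rule bounded_operatorsI[OF _ _ _ _ bound])
       (auto simp: op_add_def extensional_def ell2_add ell2_scale bounded_operators_ell2[OF S]
         bounded_operators_ell2[OF T] bounded_operators_add[OF S] bounded_operators_add[OF T]
         bounded_operators_scale[OF S] bounded_operators_scale[OF T] algebra_simps)
  show "op_norm A (op_add A S T) \<le> op_norm A S + op_norm A T"
    by (rule op_norm_le[OF _ bound]) (simp_all add: op_norm_nonneg S T)
qed

lemma
  assumes T: "T \<in> bounded_operators A"
  shows op_scale_bounded: "op_scale A c T \<in> bounded_operators A"
    and op_norm_scale_le: "op_norm A (op_scale A c T) \<le> cmod c * op_norm A T"
proof -
  have bound: "ell2_norm A (op_scale A c T x) \<le> (cmod c * op_norm A T) * ell2_norm A x"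
    if x: "x \<in> ell2 A" for x
    using mult_left_mono[OF op_norm_bound[OF T x], of "cmod c"] x
    by (simp add: op_scale_def ell2_norm_scale mult.assoc)
  show "op_scale A c T \<in> bounded_operators A"
    by (rule bounded_operatorsI[OF _ _ _ _ bound])
       (auto simp: op_scale_def extensional_def ell2_add ell2_scale bounded_operators_ell2[OF T]
         bounded_operators_add[OF T] bounded_operators_scale[OF T] algebra_simps)
  show "op_norm A (op_scale A c T) \<le> cmod c * op_norm A T"
    by (rule op_norm_le[OF _ bound]) (simp_all add: op_norm_nonneg T)
qed

lemma op_diff_eq_add_scale: "op_diff A S T = op_add A S (op_scale A (-1) T)"
  by (auto simp: op_diff_def op_add_def op_scale_def restrict_def)

lemma
  assumes S: "S \<in> bounded_operators A" and T: "T \<in> bounded_operators A"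
  shows op_diff_bounded: "op_diff A S T \<in> bounded_operators A"
    and op_norm_diff: "op_norm A (op_diff A S T) \<le> op_norm A S + op_norm A T"
  using op_add_bounded[OF S op_scale_bounded[OF T]] op_norm_add[OF S op_scale_bounded[OF T], of "-1"]
    op_norm_scale_le[OF T, of "-1"] by (simp_all add: op_diff_eq_add_scale)

lemma
  assumes S: "S \<in> bounded_operators A" and T: "T \<in> bounded_operators A"
  shows op_mult_bounded: "op_mult A S T \<in> bounded_operators A"
    and op_norm_mult: "op_norm A (op_mult A S T) \<le> op_norm A S * op_norm A T"
proof -
  have bound: "ell2_norm A (op_mult A S T x) \<le> (op_norm A S * op_norm A T) * ell2_norm A x"
    if x: "x \<in> ell2 A" for x
    using op_norm_bound[OF S bounded_operators_ell2[OF T x]] x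
      mult_left_mono[OF op_norm_bound[OF T x] op_norm_nonneg[OF S]]
    by (simp add: op_mult_def compose_def mult.assoc)
  show "op_mult A S T \<in> bounded_operators A"
    by (rule bounded_operatorsI[OF _ _ _ _ bound])
       (auto simp: op_mult_def compose_def extensional_def ell2_add ell2_scale bounded_operators_ell2[OF S]
         bounded_operators_ell2[OF T] bounded_operators_add[OF S] bounded_operators_add[OF T]
         bounded_operators_scale[OF S] bounded_operators_scale[OF T])
  show "op_norm A (op_mult A S T) \<le> op_norm A S * op_norm A T"
    by (rule op_norm_le[OF _ bound]) (simp_all add: op_norm_nonneg S T)
qed

lemma op_norm_diff_self: "T \<in> bounded_operators A \<Longrightarrow> op_norm A (op_diff A T T) = 0"
  using op_norm_zero[of A] by (simp add: op_diff_def op_zero_def)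


section \<open>Adjoints\<close>

text \<open>
  An explicit formula for the adjoint of \<open>T\<close>: it sends \<open>y\<close> to the function
  \<open>h \<mapsto> \<langle>y, T \<delta>\<^sub>h\<rangle>\<close>.  That this function is square-summable, and that the adjoint identity
  holds, is proved directly from finitely supported vectors, without the Riesz representation theorem.
\<close>

definition adjoint_op :: "'g set \<Rightarrow> 'g operator \<Rightarrow> 'g operator" where
  "adjoint_op A T =
     (\<lambda>y\<in>ell2 A. \<lambda>h. if h \<in> A then ell2_inner A y (T (ell2_delta h)) else 0)"

lemma inner_finite_support_adjoint_op:
  assumes T: "T \<in> bounded_operators A" and y: "y \<in> ell2 A"
    and F: "finite F" "F \<subseteq> A" "\<And>h. h \<notin> F \<Longrightarrow> x h = 0"
  shows "ell2_inner A (T x) y = (\<Sum>h\<in>F. x h * cnj (adjoint_op A T y h))"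
proof -
  have d: "\<And>h. h \<in> F \<Longrightarrow> ell2_delta h \<in> ell2 A"
    using F(2) by (auto intro: ell2_delta_in_ell2)
  have "T x = T (\<lambda>k. \<Sum>h\<in>F. x h * ell2_delta h k)"
    by (rule arg_cong[where f=T, OF finite_support_eq_sum_delta[OF F(1,3)]])
  also have "\<dots> = (\<lambda>k. \<Sum>h\<in>F. x h * T (ell2_delta h) k)"
    by (rule bounded_operators_sum[OF T F(1)]) (use d in auto)
  finally have Tx: "T x = (\<lambda>k. \<Sum>h\<in>F. x h * T (ell2_delta h) k)" .
  have sum: "ell2_inner A (\<lambda>k. \<Sum>h\<in>E. x h * T (ell2_delta h) k) y
      = (\<Sum>h\<in>E. x h * ell2_inner A (T (ell2_delta h)) y)" if "finite E" "E \<subseteq> F" for E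
    using that
  proof (induction E rule: finite_induct)
    case empty then show ?case by (simp add: ell2_inner_def)
  next
    case (insert i E)
    have "ell2_inner A (\<lambda>k. x i * T (ell2_delta i) k + (\<Sum>h\<in>E. x h * T (ell2_delta h) k)) y
      = ell2_inner A (\<lambda>k. x i * T (ell2_delta i) k) y
        + ell2_inner A (\<lambda>k. \<Sum>h\<in>E. x h * T (ell2_delta h) k) y"
      by (rule ell2_inner_add_left[OF _ _ y])
        (use insert.prems d in \<open>auto intro!: ell2_sum ell2_scale bounded_operators_ell2[OF T]\<close>)
    then show ?case using insert by (simp add: ell2_inner_scale_left)
  qed
  have "cnj (adjoint_op A T y h) = ell2_inner A (T (ell2_delta h)) y" if "h \<in> F" for h
  proof -
    have "h \<in> A" using F that by blast
    then show ?thesis using y ell2_inner_commute[of A "T (ell2_delta h)" y]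
      by (simp add: adjoint_op_def)
  qed
  then show ?thesis unfolding Tx sum[OF F(1) subset_refl] by simp
qed

lemma
  assumes T: "T \<in> bounded_operators A" and y: "y \<in> ell2 A"
  shows adjoint_op_ell2: "adjoint_op A T y \<in> ell2 A"
    and adjoint_op_norm_le: "ell2_norm A (adjoint_op A T y) \<le> op_norm A T * ell2_norm A y"
proof -
  let ?z = "adjoint_op A T y" and ?B = "op_norm A T * ell2_norm A y"
  have "L2_set (\<lambda>h. cmod (?z h)) F \<le> ?B" if F: "finite F" "F \<subseteq> A" for F
  proof -
    let ?x = "restr F ?z" and ?N = "L2_set (\<lambda>h. cmod (?z h)) F"
    have x: "?x \<in> ell2 A" "ell2_norm A ?x = ?N"
      using finite_support_norm[OF F, of ?x] by (auto simp: restr_def intro: L2_set_cong)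
    \<comment> \<open>Testing against the truncation of \<open>T\<^sup>*y\<close> itself gives \<open>N\<^sup>2 \<le> \<parallel>T\<parallel> N \<parallel>y\<parallel>\<close>.\<close>
    have "ell2_inner A (T ?x) y = (\<Sum>h\<in>F. ?x h * cnj (?z h))"
      by (rule inner_finite_support_adjoint_op[OF T y F]) (simp add: restr_def)
    also have "\<dots> = (\<Sum>h\<in>F. of_real ((cmod (?z h))\<^sup>2))"
      by (rule sum.cong) (auto simp: restr_def complex_norm_square[symmetric])
    also have "\<dots> = of_real (?N\<^sup>2)" by (simp add: L2_set_def sum_nonneg)
    finally have "cmod (ell2_inner A (T ?x) y) = \<bar>?N\<^sup>2\<bar>" by (metis norm_of_real)
    then have "?N\<^sup>2 = cmod (ell2_inner A (T ?x) y)" by simp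
    also have "\<dots> \<le> ell2_norm A (T ?x) * ell2_norm A y"
      by (rule Cauchy_Schwarz_ell2[OF bounded_operators_ell2[OF T x(1)] y])
    also have "\<dots> \<le> op_norm A T * ?N * ell2_norm A y"
      using op_norm_bound[OF T x(1)] x(2) by (intro mult_right_mono) auto
    finally have "?N * ?N \<le> ?B * ?N" by (simp add: power2_eq_square mult_ac)
    moreover have "0 \<le> ?B" by (simp add: op_norm_nonneg T)
    ultimately show ?thesis
      using mult_right_le_imp_le[of ?N ?N ?B] L2_set_nonneg[of "\<lambda>h. cmod (?z h)" F]
      by (cases "?N = 0") simp_all
  qed
  moreover have "?z h = 0" if "h \<notin> A" for h using that y by (simp add: adjoint_op_def)
  ultimately show "?z \<in> ell2 A" "ell2_norm A ?z \<le> ?B" using ell2I[of A ?z ?B] by auto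
qed

lemma adjoint_op_inner:
  assumes T: "T \<in> bounded_operators A" and x: "x \<in> ell2 A" and y: "y \<in> ell2 A"
  shows "ell2_inner A (T x) y = ell2_inner A x (adjoint_op A T y)"
proof -
  let ?z = "adjoint_op A T y"
  have z: "?z \<in> ell2 A" by (rule adjoint_op_ell2[OF T y])
  let ?C = "op_norm A T * ell2_norm A y + ell2_norm A ?z"
  have C: "0 \<le> ?C" by (simp add: op_norm_nonneg T)
  have "cmod (ell2_inner A (T x) y - ell2_inner A x ?z) \<le> 0 + \<epsilon>" if e: "\<epsilon> > 0" for \<epsilon>
  proof -
    have e': "\<epsilon> / (?C + 1) > 0" using e C by simp
    obtain F where F: "finite F" "F \<subseteq> A"
      and tail: "ell2_norm A (\<lambda>h. x h - restr F x h) \<le> \<epsilon> / (?C + 1)"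
      using ell2_tail[OF x e'] by blast
    let ?t = "\<lambda>h. x h - restr F x h"
    have xF: "restr F x \<in> ell2 A" by (rule restr_ell2[OF x])
    have t: "?t \<in> ell2 A" by (rule ell2_diff[OF x xF])
    have fin: "ell2_inner A (T (restr F x)) y = ell2_inner A (restr F x) ?z"
      by (subst inner_finite_support_adjoint_op[OF T y F], simp add: restr_def,
          subst ell2_inner_finite_left[OF F]) (auto simp: restr_def)
    have split: "x = (\<lambda>h. ?t h + restr F x h)" by auto
    have "ell2_inner A (T x) y = ell2_inner A (T ?t) y + ell2_inner A (T (restr F x)) y"
      by (subst split, subst bounded_operators_add[OF T t xF], rule ell2_inner_add_left)
         (intro bounded_operators_ell2[OF T] t xF y)+
    moreover have "ell2_inner A x ?z = ell2_inner A ?t ?z + ell2_inner A (restr F x) ?z"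
      by (subst split, rule ell2_inner_add_left[OF t xF z])
    ultimately have "ell2_inner A (T x) y - ell2_inner A x ?z
        = ell2_inner A (T ?t) y - ell2_inner A ?t ?z" using fin by simp
    then have "cmod (ell2_inner A (T x) y - ell2_inner A x ?z)
        \<le> cmod (ell2_inner A (T ?t) y) + cmod (ell2_inner A ?t ?z)"
      by (simp add: norm_triangle_ineq4)
    also have "\<dots> \<le> ell2_norm A (T ?t) * ell2_norm A y + ell2_norm A ?t * ell2_norm A ?z"
      by (intro add_mono Cauchy_Schwarz_ell2 bounded_operators_ell2[OF T] t y z)
    also have "\<dots> \<le> (op_norm A T * ell2_norm A ?t) * ell2_norm A y + ell2_norm A ?t * ell2_norm A ?z"
      by (intro add_mono mult_right_mono op_norm_bound[OF T t]) auto
    also have "\<dots> = ?C * ell2_norm A ?t" by (simp add: algebra_simps)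
    also have "\<dots> \<le> ?C * (\<epsilon> / (?C + 1))" by (rule mult_left_mono[OF tail C])
    also have "\<dots> \<le> \<epsilon>" using e C by (simp add: divide_simps mult.commute)
    finally show ?thesis by simp
  qed
  then have "cmod (ell2_inner A (T x) y - ell2_inner A x ?z) \<le> 0" by (rule field_le_epsilon)
  then show ?thesis by simp
qed

lemma
  assumes T: "T \<in> bounded_operators A"
  shows adjoint_op_bounded: "adjoint_op A T \<in> bounded_operators A"
    and op_norm_adjoint_op: "op_norm A (adjoint_op A T) \<le> op_norm A T"
proof -
  have d: "\<And>h. h \<in> A \<Longrightarrow> T (ell2_delta h) \<in> ell2 A"
    by (intro bounded_operators_ell2[OF T] ell2_delta_in_ell2)
  show "adjoint_op A T \<in> bounded_operators A"
  proof (rule bounded_operatorsI[OF _ adjoint_op_ell2[OF T] _ _ adjoint_op_norm_le[OF T]])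
    fix x y assume "x \<in> ell2 A" "y \<in> ell2 A"
    then show "adjoint_op A T (\<lambda>h. x h + y h) = (\<lambda>h. adjoint_op A T x h + adjoint_op A T y h)"
      by (auto simp: adjoint_op_def ell2_add d ell2_inner_add_left)
  next
    fix c x assume "x \<in> ell2 A"
    then show "adjoint_op A T (\<lambda>h. c * x h) = (\<lambda>h. c * adjoint_op A T x h)"
      by (auto simp: adjoint_op_def ell2_scale ell2_inner_scale_left)
  qed (auto simp: adjoint_op_def extensional_def)
  show "op_norm A (adjoint_op A T) \<le> op_norm A T"
    by (rule op_norm_le[OF op_norm_nonneg[OF T] adjoint_op_norm_le[OF T]])
qed

lemma op_adjoint_eqI:
  assumes S: "S \<in> bounded_operators A"
    and inner: "\<And>x y. x \<in> ell2 A \<Longrightarrow> y \<in> ell2 A \<Longrightarrow> ell2_inner A (T x) y = ell2_inner A x (S y)"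
  shows "op_adjoint A T = S"
  unfolding op_adjoint_def
proof (rule the_equality)
  fix S' assume S': "S' \<in> bounded_operators A \<and>
      (\<forall>x\<in>ell2 A. \<forall>y\<in>ell2 A. ell2_inner A (T x) y = ell2_inner A x (S' y))"
  show "S' = S"
  proof (rule bounded_operators_eqI[OF conjunct1[OF S'] S])
    fix y h assume y: "y \<in> ell2 A" and h: "h \<in> A"
    have "ell2_inner A (ell2_delta h) (S' y) = ell2_inner A (ell2_delta h) (S y)"
      using S' inner y ell2_delta_in_ell2[OF h] by metis
    then show "S' y h = S y h" by (simp add: ell2_inner_delta_left[OF h])
  qed
qed (use assms in auto)

lemma op_adjoint_eq: "T \<in> bounded_operators A \<Longrightarrow> op_adjoint A T = adjoint_op A T"
  by (rule op_adjoint_eqI[OF adjoint_op_bounded adjoint_op_inner])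

lemma op_adjoint_bounded: "T \<in> bounded_operators A \<Longrightarrow> op_adjoint A T \<in> bounded_operators A"
  by (simp add: op_adjoint_eq adjoint_op_bounded)

lemma op_norm_adjoint: "T \<in> bounded_operators A \<Longrightarrow> op_norm A (op_adjoint A T) \<le> op_norm A T"
  by (simp add: op_adjoint_eq op_norm_adjoint_op)

lemma op_adjoint_diff:
  assumes S: "S \<in> bounded_operators A" and T: "T \<in> bounded_operators A"
  shows "op_adjoint A (op_diff A S T) = op_diff A (op_adjoint A S) (op_adjoint A T)"
proof -
  have "ell2_inner A x (\<lambda>h. u h - v h) = ell2_inner A x u - ell2_inner A x v"
    "ell2_inner A (\<lambda>h. u h - v h) x = ell2_inner A u x - ell2_inner A v x"
    if "x \<in> ell2 A" "u \<in> ell2 A" "v \<in> ell2 A" for x u v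
    using ell2_inner_add_right[OF that(2) ell2_scale[OF that(3), of "-1"] that(1)]
      ell2_inner_add_left[OF that(2) ell2_scale[OF that(3), of "-1"] that(1)]
      ell2_inner_scale_right[of A x "-1" v] ell2_inner_scale_left[of A "-1" v x]
    by simp_all
  then show ?thesis
    by (intro op_adjoint_eqI op_diff_bounded op_adjoint_bounded S T)
       (simp add: op_diff_def op_adjoint_eq S T adjoint_op_inner bounded_operators_ell2[OF S]
         bounded_operators_ell2[OF T] bounded_operators_ell2[OF adjoint_op_bounded[OF S]]
         bounded_operators_ell2[OF adjoint_op_bounded[OF T]])
qed


section \<open>Formulas respect their moduli on bounded operators\<close>

text \<open>
  The ball of radius \<open>n\<close> in the algebra of all bounded operators.  The moduli of terms and formulas
  are valid on these balls; membership in the reduced C*-algebra plays no role for them.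
\<close>

definition op_ball :: "'g set \<Rightarrow> nat \<Rightarrow> 'g operator set" where
  "op_ball A n = {T \<in> bounded_operators A. op_norm A T \<le> real n}"

abbreviation op_tuple :: "'g set \<Rightarrow> nat list \<Rightarrow> 'g operator list \<Rightarrow> bool" where
  "op_tuple A \<sigma> as \<equiv> list_all2 (\<lambda>T n. T \<in> op_ball A n) as \<sigma>"

abbreviation op_dist :: "'g set \<Rightarrow> 'g operator \<Rightarrow> 'g operator \<Rightarrow> real" where
  "op_dist A S T \<equiv> op_norm A (op_diff A S T)"

lemma op_ballD: "T \<in> op_ball A n \<Longrightarrow> T \<in> bounded_operators A" "T \<in> op_ball A n \<Longrightarrow> op_norm A T \<le> real n"
  by (auto simp: op_ball_def)

lemma op_dist_triangle:
  assumes "S \<in> bounded_operators A" "T \<in> bounded_operators A" "U \<in> bounded_operators A"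
  shows "op_dist A S U \<le> op_dist A S T + op_dist A T U"
proof -
  have "op_diff A S U = op_add A (op_diff A S T) (op_diff A T U)"
    by (auto simp: op_diff_def op_add_def restrict_def)
  then show ?thesis using assms by (simp add: op_norm_add op_diff_bounded)
qed

lemma op_dist_commute:
  assumes "S \<in> bounded_operators A" "T \<in> bounded_operators A"
  shows "op_dist A S T = op_dist A T S"
proof -
  have "op_dist A S T \<le> op_dist A T S"
    if "S \<in> bounded_operators A" "T \<in> bounded_operators A" for S T :: "'a operator"
  proof -
    have "op_diff A S T = op_scale A (-1) (op_diff A T S)"
      by (auto simp: op_diff_def op_scale_def restrict_def)
    then show ?thesis using op_norm_scale_le[OF op_diff_bounded[OF that(2,1)], of "-1"] by simp
  qed
  then show ?thesis using assms by (simp add: order_antisym)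
qed

lemma op_norm_le_dist:
  assumes "S \<in> bounded_operators A" "T \<in> bounded_operators A"
  shows "op_norm A S \<le> op_norm A T + op_dist A S T"
proof -
  have "S = op_add A T (op_diff A S T)"
    using bounded_operators_ext[OF assms(1)]
    by (auto simp: op_diff_def op_add_def restrict_def extensional_def)
  then show ?thesis using op_norm_add[OF assms(2) op_diff_bounded[OF assms]] by simp
qed

lemma op_dist_add_le:
  assumes "S \<in> bounded_operators A" "T \<in> bounded_operators A"
    "S' \<in> bounded_operators A" "T' \<in> bounded_operators A"
  shows "op_dist A (op_add A S T) (op_add A S' T') \<le> op_dist A S S' + op_dist A T T'"
proof -
  have "op_diff A (op_add A S T) (op_add A S' T') = op_add A (op_diff A S S') (op_diff A T T')"
    by (rule ext) (auto simp: op_diff_def op_add_def restrict_def)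
  then show ?thesis using assms by (simp add: op_norm_add op_diff_bounded)
qed

lemma op_dist_mult_le:
  assumes "S \<in> bounded_operators A" "T \<in> bounded_operators A"
    "S' \<in> bounded_operators A" "T' \<in> bounded_operators A"
  shows "op_dist A (op_mult A S T) (op_mult A S' T')
    \<le> op_dist A S S' * op_norm A T + op_norm A S' * op_dist A T T'"
proof -
  have "op_diff A (op_mult A S T) (op_mult A S' T')
      = op_add A (op_mult A (op_diff A S S') T) (op_mult A S' (op_diff A T T'))"
    by (rule ext)
       (auto simp: op_diff_def op_add_def op_mult_def compose_def restrict_def
         bounded_operators_ell2[OF assms(2)] bounded_operators_ell2[OF assms(4)]
         bounded_operators_diff[OF assms(3)])
  then have "op_dist A (op_mult A S T) (op_mult A S' T')
      \<le> op_norm A (op_mult A (op_diff A S S') T) + op_norm A (op_mult A S' (op_diff A T T'))"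
    using assms by (simp add: op_norm_add op_mult_bounded op_diff_bounded)
  also have "\<dots> \<le> op_dist A S S' * op_norm A T + op_norm A S' * op_dist A T T'"
    by (intro add_mono op_norm_mult op_diff_bounded assms)
  finally show ?thesis .
qed

lemma op_dist_scale_le:
  assumes "S \<in> bounded_operators A" "T \<in> bounded_operators A"
  shows "op_dist A (op_scale A c S) (op_scale A c T) \<le> cmod c * op_dist A S T"
proof -
  have "op_diff A (op_scale A c S) (op_scale A c T) = op_scale A c (op_diff A S T)"
    by (auto simp: op_diff_def op_scale_def restrict_def algebra_simps)
  then show ?thesis using op_norm_scale_le[OF op_diff_bounded[OF assms]] by simp
qed

lemma op_dist_adjoint_le:
  assumes "S \<in> bounded_operators A" "T \<in> bounded_operators A"
  shows "op_dist A (op_adjoint A S) (op_adjoint A T) \<le> op_dist A S T"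
  using op_norm_adjoint[OF op_diff_bounded[OF assms]] by (simp add: op_adjoint_diff assms)

text \<open>
  Every operation of the language maps balls into the prescribed ball and respects its modulus; the
  list \<open>\<delta>\<close> bounds the distances of corresponding arguments.
\<close>

lemma operator_fun_modulus:
  assumes F: "is_cstar_fun F"
    and as: "op_tuple A (cstar_fun_dom F) as"
    and as': "op_tuple A (cstar_fun_dom F) as'"
    and \<delta>: "list_all2 (\<lambda>(S, T) d. op_dist A S T \<le> d) (zip as as') \<delta>"
  shows "operator_fun A F as \<in> op_ball A (cstar_fun_cod F)"
    and "op_dist A (operator_fun A F as) (operator_fun A F as') \<le> cstar_fun_modulus F \<delta>"
proof -
  have "operator_fun A F as \<in> op_ball A (cstar_fun_cod F) \<and>
    op_dist A (operator_fun A F as) (operator_fun A F as') \<le> cstar_fun_modulus F \<delta>"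
  proof (cases F)
    case CZero
    then show ?thesis using as as' \<delta>
      by (auto simp: op_ball_def op_zero_bounded op_norm_zero op_norm_diff_self)
  next
    case COne
    then show ?thesis using as as' \<delta>
      by (auto simp: op_ball_def op_one_bounded op_norm_one op_norm_diff_self)
  next
    case (CAdd m n)
    then obtain S T S' T' d e where [simp]: "as = [S, T]" "as' = [S', T']" "\<delta> = [d, e]"
      and b: "S \<in> op_ball A m" "T \<in> op_ball A n" "S' \<in> op_ball A m" "T' \<in> op_ball A n"
        "op_dist A S S' \<le> d" "op_dist A T T' \<le> e"
      using as as' \<delta> by (auto simp: list_all2_Cons1 list_all2_Cons2)
    show ?thesis
      using b CAdd op_norm_add[of S A T] op_dist_add_le[of S A T S' T']
      by (auto simp: op_ball_def op_add_bounded)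
  next
    case (CMult m n)
    then obtain S T S' T' d e where [simp]: "as = [S, T]" "as' = [S', T']" "\<delta> = [d, e]"
      and b: "S \<in> op_ball A m" "T \<in> op_ball A n" "S' \<in> op_ball A m" "T' \<in> op_ball A n"
        "op_dist A S S' \<le> d" "op_dist A T T' \<le> e"
      using as as' \<delta> by (auto simp: list_all2_Cons1 list_all2_Cons2)
    note bd = b(1-4)[THEN op_ballD(1)] and le = b(1-4)[THEN op_ballD(2)]
    have "op_norm A (op_mult A S T) \<le> op_norm A S * op_norm A T" by (intro op_norm_mult bd)
    also have "\<dots> \<le> real m * real n" by (intro mult_mono le op_norm_nonneg bd) auto
    finally have 1: "op_norm A (op_mult A S T) \<le> real m * real n" .
    have "op_dist A (op_mult A S T) (op_mult A S' T')
        \<le> op_dist A S S' * op_norm A T + op_norm A S' * op_dist A T T'"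
      by (intro op_dist_mult_le bd)
    also have "\<dots> \<le> d * real n + real m * e"
      using order_trans[OF op_norm_nonneg[OF op_diff_bounded[OF bd(1) bd(3)]] b(5)]
      by (intro add_mono mult_mono b le op_norm_nonneg op_diff_bounded bd) auto
    finally show ?thesis using 1 CMult by (auto simp: op_ball_def op_mult_bounded bd mult.commute)
  next
    case (CScale c n)
    then obtain S S' d where [simp]: "as = [S]" "as' = [S']" "\<delta> = [d]"
      and b: "S \<in> op_ball A n" "S' \<in> op_ball A n" "op_dist A S S' \<le> d"
      using as as' \<delta> by (auto simp: list_all2_Cons1 list_all2_Cons2)
    have "op_norm A (op_scale A c S) \<le> cmod c * op_norm A S"
      using b by (intro op_norm_scale_le op_ballD)
    also have "\<dots> \<le> cmod c * real n" using b by (intro mult_left_mono op_ballD) auto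
    also have "\<dots> \<le> real (scale_radius c n)" unfolding scale_radius_def by linarith
    finally have 1: "op_norm A (op_scale A c S) \<le> real (scale_radius c n)" .
    have "op_dist A (op_scale A c S) (op_scale A c S') \<le> cmod c * op_dist A S S'"
      using b by (intro op_dist_scale_le op_ballD)
    also have "\<dots> \<le> cmod c * d" using b by (intro mult_left_mono) auto
    finally show ?thesis using 1 CScale b by (auto simp: op_ball_def op_scale_bounded)
  next
    case (CAdj n)
    then obtain S S' d where [simp]: "as = [S]" "as' = [S']" "\<delta> = [d]"
      and b: "S \<in> op_ball A n" "S' \<in> op_ball A n" "op_dist A S S' \<le> d"
      using as as' \<delta> by (auto simp: list_all2_Cons1 list_all2_Cons2)
    show ?thesis
      using b CAdj op_norm_adjoint[of S A] op_dist_adjoint_le[of S A S']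
      by (auto simp: op_ball_def op_adjoint_bounded)
  next
    case (CIncl n k)
    then show ?thesis using as as' \<delta> F
      by (auto simp: list_all2_Cons1 list_all2_Cons2 op_ball_def)
  qed
  then show "operator_fun A F as \<in> op_ball A (cstar_fun_cod F)"
    "op_dist A (operator_fun A F as) (operator_fun A F as') \<le> cstar_fun_modulus F \<delta>" by auto
qed

lemma cstar_language_simps [simp]:
  "sorts cstar_language = {n. 1 \<le> n}" "mfun_syms cstar_language = {F. is_cstar_fun F}"
  "mfun_dom cstar_language = cstar_fun_dom" "mfun_cod cstar_language = cstar_fun_cod"
  "mfun_modulus cstar_language = cstar_fun_modulus"
  "mpred_syms cstar_language = {CDist n | n. 1 \<le> n}"
  "mpred_dom cstar_language = cstar_pred_dom" "mpred_modulus cstar_language = cstar_pred_modulus"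
  "mpred_range cstar_language = cstar_pred_range"
  by (simp_all add: cstar_language_def)

lemma trm_val_modulus:
  assumes "has_sort cstar_language \<sigma> t s"
    and as: "op_tuple A \<sigma> as" and as': "op_tuple A \<sigma> as'"
    and \<delta>: "\<And>i. i < length \<sigma> \<Longrightarrow> op_dist A (as ! i) (as' ! i) \<le> \<delta> i"
  shows "trm_val (operator_fun A) as t \<in> op_ball A s \<and>
    trm_val (operator_fun A) as' t \<in> op_ball A s \<and>
    op_dist A (trm_val (operator_fun A) as t) (trm_val (operator_fun A) as' t)
      \<le> trm_modulus cstar_language t \<delta>"
  using assms(1)
proof (induction rule: has_sort.induct)
  case (has_sort_Var i)
  then show ?case using as as' \<delta> by (auto simp: list_all2_conv_all_nth)
next
  case (has_sort_App F ts)
  let ?v = "map (trm_val (operator_fun A) as) ts"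
  let ?v' = "map (trm_val (operator_fun A) as') ts"
  let ?d = "map (\<lambda>t. trm_modulus cstar_language t \<delta>) ts"
  have F: "is_cstar_fun F" using has_sort_App by simp
  have v: "op_tuple A (cstar_fun_dom F) ?v" "op_tuple A (cstar_fun_dom F) ?v'"
    and d: "list_all2 (\<lambda>(S, T) d. op_dist A S T \<le> d) (zip ?v ?v') ?d"
    using has_sort_App(2) by (auto simp: list_all2_conv_all_nth)
  have self: "list_all2 (\<lambda>(S, T) d. op_dist A S T \<le> d) (zip ?v' ?v')
      (map (\<lambda>(S, T). op_dist A S T) (zip ?v' ?v'))"
    by (auto simp: list_all2_conv_all_nth)
  show ?case
    using operator_fun_modulus[OF F v d] operator_fun_modulus(1)[OF F v(2) v(2) self]
    by (simp add: comp_def)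
qed

lemma atomic_val_modulus:
  fixes G :: "('g, 'm) monoid_scheme"
  defines "A \<equiv> carrier G" and "M \<equiv> reduced_cstar_struct G"
  assumes wf: "wf_atomic cstar_language \<sigma> \<phi>"
    and as: "op_tuple A \<sigma> as" and as': "op_tuple A \<sigma> as'"
    and \<delta>: "\<And>i. i < length \<sigma> \<Longrightarrow> op_dist A (as ! i) (as' ! i) \<le> \<delta> i"
  shows "atomic_val M as \<phi> \<in> cstar_pred_range (atom_pred \<phi>)"
    and "\<bar>atomic_val M as \<phi> - atomic_val M as' \<phi>\<bar> \<le> atomic_modulus cstar_language \<phi> \<delta>"
proof -
  obtain n s t where \<phi>: "\<phi> = Atom (CDist n) [s, t]"
    and s: "has_sort cstar_language \<sigma> s n" and t: "has_sort cstar_language \<sigma> t n"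
    using wf by (cases \<phi>) (auto simp: wf_atomic_def list_all2_Cons2)
  let ?v = "trm_val (operator_fun A) as" and ?v' = "trm_val (operator_fun A) as'"
  note ms = trm_val_modulus[OF s as as' \<delta>] and mt = trm_val_modulus[OF t as as' \<delta>]
  have bd: "?v s \<in> bounded_operators A" "?v t \<in> bounded_operators A"
    "?v' s \<in> bounded_operators A" "?v' t \<in> bounded_operators A"
    and le: "op_norm A (?v s) \<le> real n" "op_norm A (?v t) \<le> real n"
    using ms mt by (auto dest: op_ballD)
  have vals: "atomic_val M as \<phi> = op_dist A (?v s) (?v t)"
      "atomic_val M as' \<phi> = op_dist A (?v' s) (?v' t)"
    by (simp_all add: atomic_val_def \<phi> M_def A_def reduced_cstar_struct_def)
  show "atomic_val M as \<phi> \<in> cstar_pred_range (atom_pred \<phi>)"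
    using op_norm_nonneg[OF op_diff_bounded[OF bd(1,2)]] op_norm_diff[OF bd(1,2)] le
    unfolding vals by (simp add: \<phi>)
  have "\<bar>op_dist A (?v s) (?v t) - op_dist A (?v' s) (?v' t)\<bar>
      \<le> op_dist A (?v s) (?v' s) + op_dist A (?v t) (?v' t)"
    using op_dist_triangle[OF bd(1,3,2)] op_dist_triangle[OF bd(3,4,2)]
      op_dist_triangle[OF bd(3,1,4)] op_dist_triangle[OF bd(1,2,4)]
      op_dist_commute[OF bd(1,3)] op_dist_commute[OF bd(2,4)] by linarith
  also have "\<dots> \<le> atomic_modulus cstar_language \<phi> \<delta>"
    using ms mt by (simp add: \<phi> atomic_modulus_def)
  finally show "\<bar>atomic_val M as \<phi> - atomic_val M as' \<phi>\<bar> \<le> atomic_modulus cstar_language \<phi> \<delta>"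
    by (simp add: vals)
qed

text \<open>
  The sequence of coordinatewise distances of two tuples, continued by zeros; it is unaffected by
  the truncation of a weak modulus to the length of the tuples.
\<close>

definition op_dists :: "'g set \<Rightarrow> 'g operator list \<Rightarrow> 'g operator list \<Rightarrow> nat \<Rightarrow> real" where
  "op_dists A as bs = (\<lambda>i. if i < length as then op_dist A (as ! i) (bs ! i) else 0)"

lemma op_dists_nonneg:
  assumes "op_tuple A \<sigma> as" "op_tuple A \<sigma> bs"
  shows "op_dists A as bs \<in> nonneg_seqs"
  using assms
  by (auto simp: nonneg_seqs_def op_dists_def list_all2_conv_all_nth intro!: op_norm_nonneg op_diff_bounded
      dest: op_ballD)

text \<open>
  A basic \<open>\<Omega>\<close>-formula changes by at most \<open>\<Omega>\<close> of the coordinatewise distances.  The values of the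
  atomic formulas lie in their ranges, so that both points occur in the supremum which defines the
  modulus of the connective.
\<close>

lemma basic_val_modulus:
  fixes G :: "('g, 'm) monoid_scheme"
  defines "A \<equiv> carrier G" and "M \<equiv> reduced_cstar_struct G"
  assumes \<psi>: "\<psi> \<in> basic_Omega_formulas cstar_language \<Omega> \<sigma>"
    and as: "op_tuple A \<sigma> as" and as': "op_tuple A \<sigma> as'"
  shows "ennreal \<bar>basic_val M as \<psi> - basic_val M as' \<psi>\<bar> \<le> \<Omega> (op_dists A as as')"
proof -
  let ?D = "op_dists A as as'" and ?k = "length (atoms \<psi>)"
  have len: "length as = length \<sigma>" "length as' = length \<sigma>" using as as' by (auto dest: list_all2_lengthD)
  have D: "\<And>i. i < length \<sigma> \<Longrightarrow> op_dist A (as ! i) (as' ! i) \<le> ?D i"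
    by (simp add: op_dists_def len)
  have self: "\<And>i. i < length \<sigma> \<Longrightarrow> op_dist A (as' ! i) (as' ! i) \<le> op_dist A (as' ! i) (as' ! i)" by simp
  have wf: "wf_atomic cstar_language \<sigma> (atoms \<psi> ! j)" if "j < ?k" for j
    using \<psi> that by (auto simp: basic_Omega_formulas_def wf_basic_def list_all_length)
  let ?x = "\<lambda>j\<in>{..<?k}. atomic_val M as (atoms \<psi> ! j)"
  let ?y = "\<lambda>j\<in>{..<?k}. atomic_val M as' (atoms \<psi> ! j)"
  have "?x \<in> basic_box cstar_language \<psi>" "?y \<in> basic_box cstar_language \<psi>"
    using atomic_val_modulus(1)[OF wf as[unfolded A_def] as'[unfolded A_def] D[unfolded A_def]]
      atomic_val_modulus(1)[OF wf as'[unfolded A_def] as'[unfolded A_def] self[unfolded A_def]]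
    by (auto simp: basic_box_def M_def)
  moreover have "\<forall>j<?k. \<bar>?x j - ?y j\<bar> \<le> atomic_modulus cstar_language (atoms \<psi> ! j) ?D"
    using atomic_val_modulus(2)[OF wf as[unfolded A_def] as'[unfolded A_def] D[unfolded A_def]]
    by (auto simp: M_def A_def)
  ultimately have "ennreal \<bar>basic_val M as \<psi> - basic_val M as' \<psi>\<bar> \<le> basic_modulus cstar_language \<psi> ?D"
    unfolding basic_val_def basic_modulus_def connective_modulus_def
    by (intro SUP_upper2[of "(?x, ?y)"]) auto
  also have "\<dots> \<le> truncation \<Omega> (length \<sigma>) ?D"
    using \<psi> op_dists_nonneg[OF as as'] by (auto simp: basic_Omega_formulas_def)
  also have "truncation \<Omega> (length \<sigma>) ?D = \<Omega> ?D"
    unfolding truncation_def by (rule arg_cong[where f=\<Omega>]) (auto simp: op_dists_def len)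
  finally show ?thesis .
qed


section \<open>Formal combinations of group words\<close>

text \<open>
  A formal complex combination of group terms.  Evaluated at a tuple of a group it gives an element
  of the group algebra; the same combination can be evaluated in several groups.  Repeated terms
  are allowed and terms are not reduced, so equality of lists is finer than equality of elements.
\<close>

type_synonym word_poly = "(complex \<times> group_sym trm) list"

text \<open>
  All terms of the combination use only the first \<open>n\<close> variables.
\<close>

definition wf_poly :: "nat \<Rightarrow> word_poly \<Rightarrow> bool" where
  "wf_poly n q \<longleftrightarrow> (\<forall>(c, t)\<in>set q. wf_trm group_language n t)"

abbreviation word_val :: "('g, 'm) monoid_scheme \<Rightarrow> 'g list \<Rightarrow> group_sym trm \<Rightarrow> 'g" where
  "word_val G gs t \<equiv> trm_val (group_fun G) gs t"

text \<open>
  The action of the unitary \<open>u\<^sub>g\<close>, on arbitrary functions and not only on square-summable ones.  This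
  spares side conditions in algebraic computations.
\<close>

definition left_translate :: "('g, 'm) monoid_scheme \<Rightarrow> 'g \<Rightarrow> ('g \<Rightarrow> complex) \<Rightarrow> 'g \<Rightarrow> complex" where
  "left_translate G g x = (\<lambda>k. if k \<in> carrier G then x (inv\<^bsub>G\<^esub> g \<otimes>\<^bsub>G\<^esub> k) else 0)"

text \<open>
  The action on functions of the group algebra element \<open>\<Sum> c \<cdot> u\<^sub>t\<close> obtained by evaluating the terms
  \<open>t\<close> at the tuple \<open>gs\<close>.
\<close>

definition poly_act ::
  "('g, 'm) monoid_scheme \<Rightarrow> 'g list \<Rightarrow> word_poly \<Rightarrow> ('g \<Rightarrow> complex) \<Rightarrow> 'g \<Rightarrow> complex" where
  "poly_act G gs q x = (\<lambda>k. \<Sum>(c, t)\<leftarrow>q. c * left_translate G (word_val G gs t) x k)"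

text \<open>
  The corresponding operator in the extensional encoding of \<^const>\<open>bounded_operators\<close>.
\<close>

definition poly_op :: "('g, 'm) monoid_scheme \<Rightarrow> 'g list \<Rightarrow> word_poly \<Rightarrow> 'g operator" where
  "poly_op G gs q = restrict (poly_act G gs q) (ell2 (carrier G))"

lemma group_language_simps [simp]:
  "fun_syms group_language = UNIV" "fun_arity group_language Mult = 2"
  "fun_arity group_language Inv = 1" "fun_arity group_language Unit = 0"
  by (simp_all add: group_language_def)

lemma wf_poly_simps [simp]:
  "wf_poly n []" "wf_poly n (p @ q) \<longleftrightarrow> wf_poly n p \<and> wf_poly n q"
  "wf_poly n ((c, t) # q) \<longleftrightarrow> wf_trm group_language n t \<and> wf_poly n q"
  by (auto simp: wf_poly_def)

lemma wf_trm_mono: "wf_trm L n t \<Longrightarrow> n \<le> n' \<Longrightarrow> wf_trm L n' t"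
  by (induction t) (auto simp: list_all_iff)

lemma wf_poly_mono: "wf_poly n q \<Longrightarrow> n \<le> n' \<Longrightarrow> wf_poly n' q"
  by (auto simp: wf_poly_def intro: wf_trm_mono)

lemma trm_val_append: "wf_trm L (length as) t \<Longrightarrow> trm_val I (as @ bs) t = trm_val I as t"
proof (induction t)
  case (App F ts)
  then have "map (trm_val I (as @ bs)) ts = map (trm_val I as) ts" by (auto simp: list_all_iff)
  then show ?case by (simp only: trm_val.simps)
qed (simp add: nth_append)

lemma poly_act_append:
  assumes "wf_poly (length gs) q" shows "poly_act G (gs @ es) q = poly_act G gs q"
  unfolding poly_act_def using assms
  by (intro ext arg_cong[where f=sum_list] map_cong refl) (auto simp: wf_poly_def trm_val_append)

lemma poly_op_append:
  assumes "wf_poly (length gs) q" shows "poly_op G (gs @ es) q = poly_op G gs q"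
  unfolding poly_op_def poly_act_append[OF assms] ..

lemma word_val_closed:
  assumes "group G" "gs \<in> lists (carrier G)" "wf_trm group_language (length gs) t"
  shows "word_val G gs t \<in> carrier G"
  using assms(3)
proof (induction t)
  case (Var i)
  then show ?case using assms(2) by (auto simp: in_lists_conv_set)
next
  case (App F ts)
  interpret group G by fact
  show ?case
  proof (cases F)
    case Mult
    then obtain s t where "ts = [s, t]"
      using App.prems by (auto simp: numeral_2_eq_2 length_Suc_conv)
    then show ?thesis using App Mult by simp
  next
    case Inv
    then obtain s where "ts = [s]" using App.prems by (auto simp: length_Suc_conv)
    then show ?thesis using App Inv by simp
  next
    case Unit
    then show ?thesis using App.prems by simp
  qed
qed

lemma poly_act_simps:
  "poly_act G gs [] x = (\<lambda>k. 0)"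
  "poly_act G gs ((c, t) # q) x =
     (\<lambda>k. c * left_translate G (word_val G gs t) x k + poly_act G gs q x k)"
  by (simp_all add: poly_act_def)

lemma
  assumes "group G" "g \<in> carrier G"
  shows group_unitary_bounded: "group_unitary G g \<in> bounded_operators (carrier G)"
    and group_unitary_eq: "group_unitary G g = restrict (left_translate G g) (ell2 (carrier G))"
proof -
  interpret group G by fact
  show eq: "group_unitary G g = restrict (left_translate G g) (ell2 (carrier G))"
    by (rule ext) (simp add: group_unitary_def left_translate_def)
  have le: "L2_set (\<lambda>k. cmod (left_translate G g x k)) F \<le> ell2_norm (carrier G) x"
    if x: "x \<in> ell2 (carrier G)" and F: "finite F" "F \<subseteq> carrier G" for x F
  proof -
    have "inj_on (\<lambda>k. inv\<^bsub>G\<^esub> g \<otimes>\<^bsub>G\<^esub> k) F"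
      using assms(2) F(2) by (auto simp: inj_on_def subset_iff)
    then have "L2_set (\<lambda>k. cmod (left_translate G g x k)) F
        = L2_set (\<lambda>k. cmod (x k)) ((\<lambda>k. inv\<^bsub>G\<^esub> g \<otimes>\<^bsub>G\<^esub> k) ` F)"
      unfolding L2_set_def using F(2)
      by (subst sum.reindex) (auto simp: left_translate_def intro!: sum.cong)
    also have "\<dots> \<le> ell2_norm (carrier G) x"
      using F assms(2) by (intro L2_set_le_ell2_norm x) auto
    finally show ?thesis .
  qed
  have "left_translate G g x k = 0" if "k \<notin> carrier G" for x k
    using that by (simp add: left_translate_def)
  note ell2 = ell2I[OF this le]
  show "group_unitary G g \<in> bounded_operators (carrier G)"
    unfolding eq
    by (rule bounded_operatorsI[where B=1])
       (auto simp: ell2 ell2_add ell2_scale, auto simp: left_translate_def fun_eq_iff)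
qed

lemma poly_op_Nil: "poly_op G gs [] = op_zero (carrier G)"
  by (rule ext) (simp add: poly_op_def op_zero_def poly_act_simps)

lemma poly_op_Cons:
  assumes "group G" "word_val G gs t \<in> carrier G"
  shows "poly_op G gs ((c, t) # q) = op_add (carrier G)
    (op_scale (carrier G) c (group_unitary G (word_val G gs t))) (poly_op G gs q)"
  by (rule ext)
     (auto simp: poly_op_def group_unitary_eq[OF assms] op_add_def op_scale_def poly_act_simps)

lemma poly_op_bounded:
  assumes "group G" "gs \<in> lists (carrier G)" "wf_poly (length gs) q"
  shows "poly_op G gs q \<in> bounded_operators (carrier G)"
  using assms(3)
proof (induction q)
  case Nil
  then show ?case by (simp add: poly_op_Nil op_zero_bounded)
next
  case (Cons p q)
  obtain c t where p: "p = (c, t)" by (cases p)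
  have t: "word_val G gs t \<in> carrier G"
    using word_val_closed[OF assms(1,2)] Cons.prems p by simp
  show ?case
    using Cons unfolding p poly_op_Cons[OF assms(1) t]
    by (auto intro!: op_add_bounded op_scale_bounded group_unitary_bounded assms(1) t)
qed

lemma poly_act_ell2:
  assumes "group G" "gs \<in> lists (carrier G)" "wf_poly (length gs) q" "x \<in> ell2 (carrier G)"
  shows "poly_act G gs q x \<in> ell2 (carrier G)"
  using bounded_operators_ell2[OF poly_op_bounded[OF assms(1-3)] assms(4)] assms(4)
  by (simp add: poly_op_def)

text \<open>
  The convolution product, on formal combinations.
\<close>

definition poly_mult :: "word_poly \<Rightarrow> word_poly \<Rightarrow> word_poly" where
  "poly_mult p q = concat (map (\<lambda>(c, s). map (\<lambda>(d, t). (c * d, App Mult [s, t])) q) p)"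

text \<open>
  Formal counterparts of the C*-algebra operations on combinations of group words.  With them,
  \<^const>\<open>trm_val\<close> evaluates a C*-algebra term at a tuple of formal combinations, independently of any
  group.
\<close>

fun poly_fun :: "cstar_fun \<Rightarrow> word_poly list \<Rightarrow> word_poly" where
  "poly_fun CZero [] = []"
| "poly_fun COne [] = [(1, App Unit [])]"
| "poly_fun (CAdd m n) [p, q] = p @ q"
| "poly_fun (CMult m n) [p, q] = poly_mult p q"
| "poly_fun (CScale c n) [p] = map (\<lambda>(d, t). (c * d, t)) p"
| "poly_fun (CAdj n) [p] = map (\<lambda>(d, t). (cnj d, App Inv [t])) p"
| "poly_fun (CIncl n k) [p] = p"
| "poly_fun _ _ = undefined"

lemma wf_poly_mult: "wf_poly n p \<Longrightarrow> wf_poly n q \<Longrightarrow> wf_poly n (poly_mult p q)"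
  by (fastforce simp: wf_poly_def poly_mult_def)

lemma left_translate_mult:
  assumes "group G" "g \<in> carrier G" "h \<in> carrier G"
  shows "left_translate G (g \<otimes>\<^bsub>G\<^esub> h) x = left_translate G g (left_translate G h x)"
proof -
  interpret group G by fact
  show ?thesis using assms(2,3)
    by (auto simp: left_translate_def fun_eq_iff inv_mult_group m_assoc)
qed

lemma left_translate_poly_act:
  "left_translate G g (poly_act G gs q x) k
    = (\<Sum>(d, t)\<leftarrow>q. d * left_translate G g (left_translate G (word_val G gs t) x) k)"
  by (cases "k \<in> carrier G") (simp_all add: left_translate_def[of G g] poly_act_def split_def)

lemma poly_act_mult:
  assumes "group G" "gs \<in> lists (carrier G)" "wf_poly (length gs) p" "wf_poly (length gs) q"
  shows "poly_act G gs (poly_mult p q) x = poly_act G gs p (poly_act G gs q x)"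
proof
  fix k
  show "poly_act G gs (poly_mult p q) x k = poly_act G gs p (poly_act G gs q x) k"
    using assms(3)
  proof (induction p)
    case Nil
    then show ?case by (simp add: poly_act_simps poly_mult_def)
  next
    case (Cons cs p)
    obtain c s where cs: "cs = (c, s)" by (cases cs)
    have s: "word_val G gs s \<in> carrier G"
      using word_val_closed[OF assms(1,2)] Cons.prems cs by simp
    have "(\<Sum>(d, t)\<leftarrow>map (\<lambda>(d, t). (c * d, App Mult [s, t])) q. d * left_translate G (word_val G gs t) x k)
        = c * left_translate G (word_val G gs s) (poly_act G gs q x) k"
      unfolding left_translate_poly_act using assms(4)
    proof (induction q)
      case (Cons dt q)
      obtain d t where dt: "dt = (d, t)" by (cases dt)
      have t: "word_val G gs t \<in> carrier G"
        using word_val_closed[OF assms(1,2)] Cons.prems dt by simp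
      show ?case using Cons dt by (simp add: left_translate_mult[OF assms(1) s t] distrib_left)
    qed simp
    then show ?case using Cons cs by (simp add: poly_act_def poly_mult_def)
  qed
qed

lemma poly_op_mult:
  assumes "group G" "gs \<in> lists (carrier G)" "wf_poly (length gs) p" "wf_poly (length gs) q"
  shows "poly_op G gs (poly_mult p q) = op_mult (carrier G) (poly_op G gs p) (poly_op G gs q)"
proof
  fix x
  have "poly_act G gs q x \<in> ell2 (carrier G)" if "x \<in> ell2 (carrier G)"
    by (rule poly_act_ell2[OF assms(1,2,4) that])
  then show "poly_op G gs (poly_mult p q) x = op_mult (carrier G) (poly_op G gs p) (poly_op G gs q) x"
    using poly_act_mult[OF assms] by (simp add: poly_op_def op_mult_def compose_def)
qed

lemma poly_act_inner_adjoint: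
  assumes "group G" "gs \<in> lists (carrier G)" "wf_poly (length gs) q"
    and x: "x \<in> ell2 (carrier G)" and y: "y \<in> ell2 (carrier G)"
  shows "ell2_inner (carrier G) (poly_act G gs q x) y
    = ell2_inner (carrier G) x (poly_act G gs (poly_fun (CAdj 1) [q]) y)"
  using assms(3)
proof (induction q)
  case Nil
  then show ?case by (simp add: poly_act_simps ell2_inner_def)
next
  case (Cons ct q)
  interpret group G by fact
  let ?A = "carrier G"
  obtain c t where ct: "ct = (c, t)" by (cases ct)
  let ?g = "word_val G gs t"
  have g: "?g \<in> ?A" using word_val_closed[OF assms(1,2)] Cons.prems ct by simp
  have u: "left_translate G h z \<in> ell2 ?A" if "h \<in> ?A" "z \<in> ell2 ?A" for h z
    using bounded_operators_ell2[OF group_unitary_bounded[OF assms(1) that(1)] that(2)]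
      group_unitary_eq[OF assms(1) that(1)] that(2) by simp
  have p: "poly_act G gs q z \<in> ell2 ?A" if "z \<in> ell2 ?A" "wf_poly (length gs) q" for q z
    by (rule poly_act_ell2[OF assms(1,2) that(2,1)])
  have wf: "wf_poly (length gs) q" "wf_poly (length gs) (poly_fun (CAdj 1) [q])"
    using Cons.prems ct by (auto simp: wf_poly_def)
  have unit: "ell2_inner ?A (left_translate G ?g x) y = ell2_inner ?A x (left_translate G (inv\<^bsub>G\<^esub> ?g) y)"
    unfolding ell2_inner_def
    by (rule infsum_reindex_bij_witness[of _ "\<lambda>k. ?g \<otimes>\<^bsub>G\<^esub> k" "\<lambda>k. inv\<^bsub>G\<^esub> ?g \<otimes>\<^bsub>G\<^esub> k"])
       (use g in \<open>auto simp: left_translate_def m_assoc[symmetric]\<close>)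
  have "ell2_inner ?A (poly_act G gs (ct # q) x) y
      = c * ell2_inner ?A (left_translate G ?g x) y + ell2_inner ?A (poly_act G gs q x) y"
    unfolding ct poly_act_simps
    by (subst ell2_inner_add_left) (auto simp: ell2_inner_scale_left intro!: ell2_scale u g x y p wf)
  also have "\<dots> = ell2_inner ?A x (poly_act G gs (poly_fun (CAdj 1) [ct # q]) y)"
    unfolding ct poly_fun.simps list.map prod.case poly_act_simps
    by (subst ell2_inner_add_right)
       (use Cons.IH[OF wf(1)] wf(2) g in \<open>auto simp: unit ell2_inner_scale_right intro!: ell2_scale u x y p\<close>)
  finally show ?case .
qed

text \<open>
  Evaluation at a tuple of group elements commutes with all C*-algebra operations.  In the case of the
  adjoint this uses \<open>u\<^sub>g\<^sup>* = u\<^sub>h\<close> for the inverse \<open>h\<close> of \<open>g\<close>.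
\<close>

lemma operator_fun_poly_op:
  assumes G: "group G" and gs: "gs \<in> lists (carrier G)"
    and "is_cstar_fun F" "length qs = length (cstar_fun_dom F)"
    and qs: "list_all (wf_poly (length gs)) qs"
  shows "wf_poly (length gs) (poly_fun F qs)"
    and "operator_fun (carrier G) F (map (poly_op G gs) qs) = poly_op G gs (poly_fun F qs)"
proof -
  interpret group G by fact
  have "wf_poly (length gs) (poly_fun F qs) \<and>
    operator_fun (carrier G) F (map (poly_op G gs) qs) = poly_op G gs (poly_fun F qs)"
  proof (cases F)
    case CZero
    then show ?thesis using assms by (simp add: poly_op_Nil)
  next
    case COne
    have "op_one (carrier G) x = poly_op G gs [(1, App Unit [])] x" for x
      by (auto simp: op_one_def poly_op_def poly_act_simps left_translate_def fun_eq_iff ell2D)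
    then show ?thesis using COne assms by auto
  next
    case (CAdd m n)
    then obtain p q where "qs = [p, q]"
      using assms(4) by (auto simp: length_Suc_conv)
    then show ?thesis using CAdd qs
      by (auto simp: op_add_def poly_op_def poly_act_def fun_eq_iff)
  next
    case (CMult m n)
    then obtain p q where "qs = [p, q]"
      using assms(4) by (auto simp: length_Suc_conv)
    then show ?thesis using CMult qs
      by (simp add: poly_op_mult[OF G gs] wf_poly_mult)
  next
    case (CScale c n)
    then obtain p where p: "qs = [p]" using assms(4) by (auto simp: length_Suc_conv)
    have "c * poly_act G gs p x k = poly_act G gs (map (\<lambda>(d, t). (c * d, t)) p) x k" for x k
      by (induction p) (auto simp: poly_act_simps distrib_left)
    then show ?thesis using CScale qs p
      by (auto simp: op_scale_def poly_op_def fun_eq_iff wf_poly_def)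
  next
    case (CAdj n)
    then obtain p where p: "qs = [p]" using assms(4) by (auto simp: length_Suc_conv)
    have wf: "wf_poly (length gs) p" "wf_poly (length gs) (poly_fun (CAdj n) [p])"
      using qs p by (auto simp: wf_poly_def)
    have "op_adjoint (carrier G) (poly_op G gs p) = poly_op G gs (poly_fun (CAdj n) [p])"
      by (rule op_adjoint_eqI[OF poly_op_bounded[OF G gs wf(2)]])
         (use poly_act_inner_adjoint[OF G gs wf(1)] in \<open>simp add: poly_op_def\<close>)
    then show ?thesis using CAdj wf p by simp
  next
    case (CIncl n k)
    then obtain p where p: "qs = [p]" using assms(4) by (auto simp: length_Suc_conv)
    then show ?thesis using CIncl qs by simp
  qed
  then show "wf_poly (length gs) (poly_fun F qs)"
    "operator_fun (carrier G) F (map (poly_op G gs) qs) = poly_op G gs (poly_fun F qs)" by auto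
qed

text \<open>
  The value of a C*-algebra term at group algebra elements is given by a formal combination which
  depends on the term and on the formal arguments only.
\<close>

lemma trm_val_poly_op:
  assumes "group G" "gs \<in> lists (carrier G)" "has_sort cstar_language \<sigma> t s"
    "length qs = length \<sigma>" "list_all (wf_poly (length gs)) qs"
  shows "wf_poly (length gs) (trm_val poly_fun qs t) \<and>
    trm_val (operator_fun (carrier G)) (map (poly_op G gs) qs) t
      = poly_op G gs (trm_val poly_fun qs t)"
  using assms(3)
proof (induction rule: has_sort.induct)
  case (has_sort_Var i)
  then show ?case using assms(4,5) by (simp add: list_all_length)
next
  case (has_sort_App F ts)
  let ?qs = "map (trm_val poly_fun qs) ts"
  have "list_all (wf_poly (length gs)) ?qs"
    and eq: "map (trm_val (operator_fun (carrier G)) (map (poly_op G gs) qs)) ts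
        = map (poly_op G gs) ?qs"
    using has_sort_App(2) by (auto simp: list_all2_conv_all_nth list_all_length intro!: nth_equalityI simp del: map_eq_conv)
  moreover have "length ?qs = length (cstar_fun_dom F)" "is_cstar_fun F"
    using has_sort_App by (auto dest: list_all2_lengthD)
  ultimately show ?case
    using operator_fun_poly_op[OF assms(1,2), of F ?qs] by (simp only: trm_val.simps eq simp_thms)
qed


section \<open>Norms of word combinations\<close>

text \<open>
  The tuples satisfy the same equations between group terms.
\<close>

definition same_equations ::
  "('g, 'm) monoid_scheme \<Rightarrow> 'g list \<Rightarrow> ('h, 'k) monoid_scheme \<Rightarrow> 'h list \<Rightarrow> bool" where
  "same_equations G gs H hs \<longleftrightarrow> length gs = length hs \<and>
     (\<forall>s t. wf_trm group_language (length gs) s \<longrightarrow> wf_trm group_language (length gs) t \<longrightarrow>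
        (word_val G gs s = word_val G gs t \<longleftrightarrow> word_val H hs s = word_val H hs t))"

lemma same_equations_commute: "same_equations G gs H hs \<Longrightarrow> same_equations H hs G gs"
  by (auto simp: same_equations_def)

text \<open>
  The vector \<open>\<Sum> c \<cdot> \<delta>\<^sub>t\<close>; it is the image of \<open>\<delta>\<^sub>1\<close> under the combination \<open>\<Sum> c \<cdot> u\<^sub>t\<close>, so that the action
  of combinations on such vectors is the formal product.
\<close>

abbreviation poly_vec :: "('g, 'm) monoid_scheme \<Rightarrow> 'g list \<Rightarrow> word_poly \<Rightarrow> 'g \<Rightarrow> complex" where
  "poly_vec G gs l \<equiv> poly_act G gs l (ell2_delta \<one>\<^bsub>G\<^esub>)"

lemma left_translate_delta_one:
  assumes "group G" "g \<in> carrier G"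
  shows "left_translate G g (ell2_delta \<one>\<^bsub>G\<^esub>) = ell2_delta g"
proof -
  interpret group G by fact
  have "inv\<^bsub>G\<^esub> g \<otimes>\<^bsub>G\<^esub> k = \<one>\<^bsub>G\<^esub> \<longleftrightarrow> k = g" if "k \<in> carrier G" for k
    using that assms(2) by (simp add: inv_solve_left')
  then show ?thesis using assms(2) by (auto simp: left_translate_def ell2_delta_def fun_eq_iff)
qed

lemma poly_vec_eq:
  assumes "group G" "gs \<in> lists (carrier G)" "wf_poly (length gs) l"
  shows "poly_vec G gs l k = (\<Sum>(c, t)\<leftarrow>l. c * ell2_delta (word_val G gs t) k)"
  unfolding poly_act_def using assms(3)
  by (intro arg_cong[where f=sum_list] map_cong refl)
     (auto simp: left_translate_delta_one[OF assms(1) word_val_closed[OF assms(1,2)]] wf_poly_def)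

text \<open>
  The norm in terms of a set \<open>R\<close> of terms which represents each point of the support exactly once.
\<close>

lemma poly_vec_norm:
  assumes G: "group G" and gs: "gs \<in> lists (carrier G)" and l: "wf_poly (length gs) l"
    and R: "finite R" "inj_on (word_val G gs) R" "word_val G gs ` R = word_val G gs ` snd ` set l"
  shows "ell2_norm (carrier G) (poly_vec G gs l)
      = L2_set (\<lambda>r. cmod (\<Sum>(c, t)\<leftarrow>l. if word_val G gs t = word_val G gs r then c else 0)) R"
proof -
  let ?V = "word_val G gs ` snd ` set l"
  have V: "finite ?V" "?V \<subseteq> carrier G"
    using word_val_closed[OF G gs] l by (auto simp: wf_poly_def)
  have zero: "poly_vec G gs l k = 0" if "k \<notin> ?V" for k
  proof -
    have "poly_vec G gs l k = (\<Sum>(c, t)\<leftarrow>l. 0)"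
      unfolding poly_vec_eq[OF G gs l]
      by (intro arg_cong[where f=sum_list] map_cong refl) (use that in \<open>force simp: ell2_delta_def\<close>)
    then show ?thesis by (simp add: case_prod_unfold)
  qed
  have "ell2_norm (carrier G) (poly_vec G gs l) = L2_set (\<lambda>k. cmod (poly_vec G gs l k)) ?V"
    by (rule finite_support_norm(2)[OF V zero])
  also have "\<dots> = L2_set (\<lambda>r. cmod (poly_vec G gs l (word_val G gs r))) R"
    unfolding L2_set_def R(3)[symmetric] by (simp add: sum.reindex[OF R(2)])
  also have "\<dots> = L2_set (\<lambda>r. cmod (\<Sum>(c, t)\<leftarrow>l. if word_val G gs t = word_val G gs r then c else 0)) R"
    unfolding poly_vec_eq[OF G gs l]
    by (intro L2_set_cong refl arg_cong[where f=cmod] arg_cong[where f=sum_list] map_cong)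
       (auto simp: ell2_delta_def)
  finally show "ell2_norm (carrier G) (poly_vec G gs l)
      = L2_set (\<lambda>r. cmod (\<Sum>(c, t)\<leftarrow>l. if word_val G gs t = word_val G gs r then c else 0)) R" .
qed

text \<open>
  The norm of \<open>\<Sum> c \<cdot> \<delta>\<^sub>t\<close> depends only on which terms coincide: terms representing the points of the
  support once in \<open>G\<close> also do so in \<open>H\<close>.
\<close>

lemma poly_vec_norm_eq:
  assumes G: "group G" "gs \<in> lists (carrier G)" and H: "group H" "hs \<in> lists (carrier H)"
    and same: "same_equations G gs H hs" and l: "wf_poly (length gs) l"
  shows "ell2_norm (carrier G) (poly_vec G gs l) = ell2_norm (carrier H) (poly_vec H hs l)"
proof -
  obtain R where R: "R \<subseteq> snd ` set l" "inj_on (word_val G gs) R"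
    "word_val G gs ` R = word_val G gs ` snd ` set l"
    using subset_image_inj[of "word_val G gs ` snd ` set l" "word_val G gs" "snd ` set l"] by auto
  have fin: "finite R" using finite_subset[OF R(1)] by simp
  have eq: "word_val G gs s = word_val G gs t \<longleftrightarrow> word_val H hs s = word_val H hs t"
    if "s \<in> snd ` set l" "t \<in> snd ` set l" for s t
  proof -
    have "wf_trm group_language (length gs) s" "wf_trm group_language (length gs) t"
      using that l by (auto simp: wf_poly_def)
    then show ?thesis using same by (simp add: same_equations_def)
  qed
  have lH: "wf_poly (length hs) l" using same l by (simp add: same_equations_def)
  have inj: "inj_on (word_val H hs) R"
  proof (rule inj_onI)
    fix s t assume st: "s \<in> R" "t \<in> R" "word_val H hs s = word_val H hs t"
    then have "word_val G gs s = word_val G gs t" using eq[of s t] R(1) by auto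
    then show "s = t" using R(2) st by (auto dest: inj_onD)
  qed
  have img: "word_val H hs ` R = word_val H hs ` snd ` set l"
  proof (intro equalityI subsetI)
    fix v assume "v \<in> word_val H hs ` snd ` set l"
    then obtain t where t: "t \<in> snd ` set l" "v = word_val H hs t" by blast
    then obtain r where "r \<in> R" "word_val G gs t = word_val G gs r"
      using R(3) by (metis imageE imageI)
    then show "v \<in> word_val H hs ` R" using t eq[of t r] R(1) by blast
  qed (use R(1) in auto)
  have "(\<Sum>(c, t)\<leftarrow>l. if word_val G gs t = word_val G gs r then c else 0)
      = (\<Sum>(c, t)\<leftarrow>l. if word_val H hs t = word_val H hs r then c else 0)" if "r \<in> R" for r
  proof (intro arg_cong[where f=sum_list] map_cong refl)
    fix ct assume "ct \<in> set l"
    then have "word_val G gs (snd ct) = word_val G gs r \<longleftrightarrow> word_val H hs (snd ct) = word_val H hs r"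
      using eq[of "snd ct" r] that R(1) by auto
    then show "(case ct of (c, t) \<Rightarrow> if word_val G gs t = word_val G gs r then c else 0)
        = (case ct of (c, t) \<Rightarrow> if word_val H hs t = word_val H hs r then c else 0)"
      by (simp add: case_prod_unfold)
  qed
  then show ?thesis
    unfolding poly_vec_norm[OF G l fin R(2,3)] poly_vec_norm[OF H lH fin inj img]
    by (intro L2_set_cong refl arg_cong[where f=cmod]) simp
qed

text \<open>
  The combination \<open>\<Sum>\<^sub>j x(c\<^sub>j) v\<close> with \<open>v\<close> the variable number \<open>n + j\<close>, where the variables from \<open>n\<close> on stand
  for the entries \<open>c\<^sub>j\<close> of the list \<open>cs\<close>.
\<close>

definition lin_comb :: "nat \<Rightarrow> ('g \<Rightarrow> complex) \<Rightarrow> 'g list \<Rightarrow> word_poly" where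
  "lin_comb n x cs = map (\<lambda>j. (x (cs ! j), Var (n + j))) [0..<length cs]"

lemma wf_lin_comb: "wf_poly (n + length cs) (lin_comb n x cs)"
  by (auto simp: lin_comb_def wf_poly_def)

lemma sum_lin_comb:
  assumes "distinct cs"
  shows "(\<Sum>(c, t)\<leftarrow>lin_comb (length gs) x cs. c * f (word_val G (gs @ cs) t))
    = (\<Sum>h\<in>set cs. x h * (f h :: complex))"
proof -
  have "(\<Sum>(c, t)\<leftarrow>lin_comb (length gs) x cs. c * f (word_val G (gs @ cs) t))
      = (\<Sum>h\<leftarrow>map (\<lambda>j. cs ! j) [0..<length cs]. x h * f h)"
    unfolding lin_comb_def by (simp add: comp_def)
  then show ?thesis using assms by (simp add: map_nth sum_list_distinct_conv_sum_set)
qed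

lemma poly_vec_lin_comb:
  assumes "group G" "gs \<in> lists (carrier G)" "cs \<in> lists (carrier G)" "distinct cs"
  shows "poly_vec G (gs @ cs) (lin_comb (length gs) x cs) = restr (set cs) x"
proof
  fix k
  have wf: "wf_poly (length (gs @ cs)) (lin_comb (length gs) x cs)" by (simp add: wf_lin_comb)
  have "poly_vec G (gs @ cs) (lin_comb (length gs) x cs) k = (\<Sum>h\<in>set cs. x h * ell2_delta h k)"
    by (subst poly_vec_eq[OF assms(1) _ wf])
       (use assms sum_lin_comb[OF assms(4), where gs=gs and x=x and f="\<lambda>h. ell2_delta h k" and G=G] in auto)
  then show "poly_vec G (gs @ cs) (lin_comb (length gs) x cs) k = restr (set cs) x k"
    by (simp add: restr_def ell2_delta_def if_distrib cong: if_cong)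
qed

text \<open>
  One half of the equality of norms.  To bound \<open>\<parallel>T x\<parallel>\<close> it is enough to bound the norm of \<open>T x\<close> on each
  finite set \<open>F\<close>.  The values of \<open>T x\<close> on \<open>F\<close> depend on the values of \<open>x\<close> at a finite set \<open>S\<close> only, so
  \<open>x\<close> may be truncated to \<open>S\<close>.  Enumerating \<open>S\<close> by \<open>cs\<close> and passing to a matching tuple \<open>ds\<close> of \<open>H\<close>
  gives a vector of the same norm over \<open>H\<close> with an image of the same norm.
\<close>

lemma poly_op_norm_le:
  assumes G: "group G" and gs: "gs \<in> lists (carrier G)"
    and H: "group H" and hs: "hs \<in> lists (carrier H)" and len: "length gs = length hs"
    and ext: "\<And>cs. cs \<in> lists (carrier G) \<Longrightarrow>
      \<exists>ds\<in>lists (carrier H). length ds = length cs \<and> same_equations G (gs @ cs) H (hs @ ds)"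
    and q: "wf_poly (length gs) q"
  shows "op_norm (carrier G) (poly_op G gs q) \<le> op_norm (carrier H) (poly_op H hs q)"
proof -
  interpret group G by fact
  let ?A = "carrier G" and ?B = "carrier H"
  let ?N = "op_norm ?B (poly_op H hs q)"
  have qH: "wf_poly (length hs) q" using q len by simp
  note bd = poly_op_bounded[OF G gs q] poly_op_bounded[OF H hs qH]
  show ?thesis
  proof (rule op_norm_le[OF op_norm_nonneg[OF bd(2)]])
    fix x assume x: "x \<in> ell2 ?A"
    show "ell2_norm ?A (poly_op G gs q x) \<le> ?N * ell2_norm ?A x"
    proof (rule ell2I(2))
      show "poly_op G gs q x h = 0" if "h \<notin> ?A" for h
        using bounded_operators_ell2[OF bd(1) x] that by (rule ell2D)
    next
      fix F assume F: "finite F" "F \<subseteq> ?A"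
      define S where "S = (\<Union>(c, t)\<in>set q. (\<lambda>k. inv\<^bsub>G\<^esub> (word_val G gs t) \<otimes>\<^bsub>G\<^esub> k) ` F)"
      have "word_val G gs t \<in> ?A" if "(c, t) \<in> set q" for c t
        using that q by (intro word_val_closed[OF G gs]) (auto simp: wf_poly_def)
      then have S: "finite S" "S \<subseteq> ?A"
        using F by (auto simp: S_def subset_iff)
      obtain cs where cs: "set cs = S" "distinct cs" using finite_distinct_list[OF S(1)] by blast
      have csl: "cs \<in> lists ?A" using cs S by auto
      let ?xS = "restr S x" and ?l = "lin_comb (length gs) x cs"
      have xS: "?xS \<in> ell2 ?A" by (rule restr_ell2[OF x])
      have vec: "poly_vec G (gs @ cs) ?l = ?xS"
        using poly_vec_lin_comb[OF G gs csl cs(2)] cs(1) by simp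
      obtain ds where ds: "ds \<in> lists ?B" "length ds = length cs"
        and same: "same_equations G (gs @ cs) H (hs @ ds)"
        using ext[OF csl] by blast
      have gcs: "gs @ cs \<in> lists ?A" and hds: "hs @ ds \<in> lists ?B" using gs csl hs ds by auto
      have lwf: "wf_poly (length (gs @ cs)) ?l" "wf_poly (length (hs @ ds)) ?l"
        using wf_lin_comb[of "length gs" cs x] len ds(2) by simp_all
      have qwf: "wf_poly (length (gs @ cs)) q" "wf_poly (length (hs @ ds)) q"
        using q qH by (auto intro: wf_poly_mono)
      have vH: "poly_vec H (hs @ ds) ?l \<in> ell2 ?B"
        using group.is_monoid[OF H]
        by (intro poly_act_ell2[OF H hds lwf(2)] ell2_delta_in_ell2) (rule monoid.one_closed)
      have "L2_set (\<lambda>h. cmod (poly_op G gs q x h)) F = L2_set (\<lambda>h. cmod (poly_op G gs q ?xS h)) F"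
      proof (intro L2_set_cong refl arg_cong[where f=cmod])
        fix k assume k: "k \<in> F"
        have "left_translate G (word_val G gs t) x k = left_translate G (word_val G gs t) ?xS k"
          if "(c, t) \<in> set q" for c t
        proof -
          have "inv\<^bsub>G\<^esub> (word_val G gs t) \<otimes>\<^bsub>G\<^esub> k \<in> S" using that k by (auto simp: S_def)
          then show ?thesis by (simp add: left_translate_def restr_def)
        qed
        then have "poly_act G gs q x k = poly_act G gs q ?xS k"
          unfolding poly_act_def by (intro arg_cong[where f=sum_list] map_cong refl) auto
        then show "poly_op G gs q x k = poly_op G gs q ?xS k"
          using x xS by (simp add: poly_op_def)
      qed
      also have "\<dots> \<le> ell2_norm ?A (poly_op G gs q ?xS)"
        by (rule L2_set_le_ell2_norm[OF bounded_operators_ell2[OF bd(1) xS] F])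
      also have "poly_op G gs q ?xS = poly_vec G (gs @ cs) (poly_mult q ?l)"
        using xS by (simp add: poly_op_def vec poly_act_mult[OF G gcs qwf(1) lwf(1)] poly_act_append[OF q])
      also have "ell2_norm ?A (poly_vec G (gs @ cs) (poly_mult q ?l))
          = ell2_norm ?B (poly_vec H (hs @ ds) (poly_mult q ?l))"
        by (rule poly_vec_norm_eq[OF G gcs H hds same wf_poly_mult[OF qwf(1) lwf(1)]])
      also have "poly_vec H (hs @ ds) (poly_mult q ?l) = poly_op H hs q (poly_vec H (hs @ ds) ?l)"
        using vH by (simp add: poly_op_def poly_act_mult[OF H hds qwf(2) lwf(2)] poly_act_append[OF qH])
      also have "ell2_norm ?B \<dots> \<le> ?N * ell2_norm ?B (poly_vec H (hs @ ds) ?l)"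
        by (rule op_norm_bound[OF bd(2) vH])
      also have "ell2_norm ?B (poly_vec H (hs @ ds) ?l) = ell2_norm ?A ?xS"
        using poly_vec_norm_eq[OF G gcs H hds same lwf(1)] vec by simp
      also have "?N * ell2_norm ?A ?xS \<le> ?N * ell2_norm ?A x"
        by (intro mult_left_mono restr_ell2(2)[OF x] op_norm_nonneg[OF bd(2)])
      finally show "L2_set (\<lambda>h. cmod (poly_op G gs q x h)) F \<le> ?N * ell2_norm ?A x" .
    qed
  qed
qed


section \<open>Word combinations in the reduced group C*-algebra\<close>

lemma sum_list_group:
  fixes U :: "'g \<Rightarrow> complex"
  assumes "finite F" "v ` snd ` set q \<subseteq> F"
  shows "(\<Sum>g\<in>F. (\<Sum>(a, t)\<leftarrow>q. if v t = g then a else 0) * U g) = (\<Sum>(a, t)\<leftarrow>q. a * U (v t))"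
  using assms(2)
proof (induction q)
  case (Cons p q)
  obtain a t where p: "p = (a, t)" by (cases p)
  have "(\<Sum>g\<in>F. (if v t = g then a else 0) * U g) = a * U (v t)"
    using Cons.prems assms(1) p by (simp add: if_distrib[of "\<lambda>z. z * _"] cong: if_cong)
  then show ?case using Cons p by (simp add: distrib_right sum.distrib)
qed simp

lemma poly_op_in_group_algebra:
  assumes G: "group G" and gs: "gs \<in> lists (carrier G)" and q: "wf_poly (length gs) q"
  shows "poly_op G gs q \<in> group_algebra G"
proof -
  let ?v = "word_val G gs"
  let ?F = "?v ` snd ` set q" and ?c = "\<lambda>g. \<Sum>(a, t)\<leftarrow>q. if ?v t = g then a else 0"
  have F: "finite ?F" "?F \<subseteq> carrier G"
    using word_val_closed[OF G gs] q by (auto simp: wf_poly_def)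
  have "poly_op G gs q = (\<lambda>x\<in>ell2 (carrier G). \<lambda>k. \<Sum>g\<in>?F. ?c g * group_unitary G g x k)"
  proof (rule ext)
    fix x
    show "poly_op G gs q x = (\<lambda>x\<in>ell2 (carrier G). \<lambda>k. \<Sum>g\<in>?F. ?c g * group_unitary G g x k) x"
    proof (cases "x \<in> ell2 (carrier G)")
      case True
      have "(\<Sum>g\<in>?F. ?c g * group_unitary G g x k) = poly_act G gs q x k" for k
      proof -
        have "(\<Sum>g\<in>?F. ?c g * group_unitary G g x k) = (\<Sum>g\<in>?F. ?c g * left_translate G g x k)"
        proof (rule sum.cong)
          fix g assume "g \<in> ?F"
          then have "g \<in> carrier G" using F(2) by blast
          then show "?c g * group_unitary G g x k = ?c g * left_translate G g x k"
            using True by (simp add: group_unitary_eq[OF G])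
        qed simp
        then show ?thesis
          using sum_list_group[OF F(1) subset_refl, of "\<lambda>g. left_translate G g x k"]
          by (simp add: poly_act_def)
      qed
      then show ?thesis using True by (simp add: poly_op_def)
    qed (simp add: poly_op_def)
  qed
  then show ?thesis
    unfolding group_algebra_def mem_Collect_eq using F
    by (intro exI[of _ ?F] exI[of _ ?c] conjI)
qed

text \<open>
  An element of the group algebra is a combination of words over an extension of any given tuple.
\<close>

lemma group_algebra_eq_poly_op:
  assumes G: "group G" and "S \<in> group_algebra G" and gs: "gs \<in> lists (carrier G)"
  obtains es q where "es \<in> lists (carrier G)" "wf_poly (length (gs @ es)) q"
    "S = poly_op G (gs @ es) q"
proof -
  obtain F c where F: "finite F" "F \<subseteq> carrier G"
    and S: "S = (\<lambda>x\<in>ell2 (carrier G). \<lambda>k. \<Sum>g\<in>F. c g * group_unitary G g x k)"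
    using assms(2) unfolding group_algebra_def by blast
  obtain es where es: "set es = F" "distinct es" using finite_distinct_list[OF F(1)] by blast
  have "S x = poly_op G (gs @ es) (lin_comb (length gs) c es) x" for x
  proof (cases "x \<in> ell2 (carrier G)")
    case True
    have "(\<Sum>g\<in>F. c g * group_unitary G g x k) = poly_act G (gs @ es) (lin_comb (length gs) c es) x k" for k
    proof -
      have "(\<Sum>g\<in>F. c g * group_unitary G g x k) = (\<Sum>g\<in>F. c g * left_translate G g x k)"
        using F(2) True by (intro sum.cong) (auto simp: group_unitary_eq[OF G])
      then show ?thesis
        using sum_lin_comb[OF es(2), where gs=gs and x=c and f="\<lambda>g. left_translate G g x k" and G=G]
        by (simp add: poly_act_def es(1))
    qed
    then show ?thesis using True by (simp add: poly_op_def S)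
  qed (simp add: poly_op_def S)
  then show ?thesis
    using that[of es "lin_comb (length gs) c es"] es F wf_lin_comb[of "length gs" es c] by auto
qed

lemma poly_op_in_reduced_cstar:
  assumes "group G" "gs \<in> lists (carrier G)" "wf_poly (length gs) q"
  shows "poly_op G gs q \<in> reduced_cstar G"
  unfolding reduced_cstar_def
  using poly_op_bounded[OF assms] poly_op_in_group_algebra[OF assms]
  by (auto intro!: bexI[of _ "poly_op G gs q"] simp: op_norm_diff_self)

text \<open>
  Elements of the ball of radius \<open>n\<close> are approximated by group algebra elements of the same ball.
\<close>

lemma reduced_cstar_approx:
  assumes G: "group G" and gs: "gs \<in> lists (carrier G)"
    and T: "T \<in> reduced_cstar G" "op_norm (carrier G) T \<le> real n" and n: "1 \<le> n" and "\<delta> > 0"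
  obtains es q where "es \<in> lists (carrier G)" "wf_poly (length (gs @ es)) q"
    "poly_op G (gs @ es) q \<in> op_ball (carrier G) n"
    "op_dist (carrier G) T (poly_op G (gs @ es) q) \<le> \<delta>"
proof -
  let ?A = "carrier G"
  have Tb: "T \<in> bounded_operators ?A" using T by (simp add: reduced_cstar_def)
  obtain S where S: "S \<in> group_algebra G" and dS: "op_dist ?A T S < \<delta> / 2"
    using T(1) \<open>\<delta> > 0\<close> half_gt_zero unfolding reduced_cstar_def by blast
  obtain es p where es: "es \<in> lists ?A" and p: "wf_poly (length (gs @ es)) p"
    and Sp: "S = poly_op G (gs @ es) p"
    by (rule group_algebra_eq_poly_op[OF G S gs])
  have ges: "gs @ es \<in> lists ?A" using gs es by simp
  have Sb: "S \<in> bounded_operators ?A" unfolding Sp by (rule poly_op_bounded[OF G ges p])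
  have nS: "op_norm ?A S \<le> real n + \<delta> / 2"
    using op_norm_le_dist[OF Sb Tb] op_dist_commute[OF Sb Tb] T(2) dS by simp
  \<comment> \<open>The approximant \<open>S\<close> may leave the ball by \<open>\<delta> / 2\<close>; this factor moves it back into the ball and
    costs another \<open>\<delta> / 2\<close>.\<close>
  let ?r = "real n / (real n + \<delta> / 2)"
  have pos: "real n + \<delta> / 2 > 0" using n \<open>\<delta> > 0\<close> by simp
  have r: "0 \<le> ?r" "?r \<le> 1" using pos \<open>\<delta> > 0\<close> by (auto simp: divide_simps)
  let ?q = "poly_fun (CScale (of_real ?r) 1) [p]"
  have q: "wf_poly (length (gs @ es)) ?q"
    and eq: "op_scale ?A (of_real ?r) S = poly_op G (gs @ es) ?q"
    using operator_fun_poly_op[OF G ges, of "CScale (of_real ?r) 1" "[p]"] p Sp by auto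
  have "op_norm ?A (op_scale ?A (of_real ?r) S) \<le> cmod (of_real ?r) * op_norm ?A S"
    by (rule op_norm_scale_le[OF Sb])
  also have "\<dots> = ?r * op_norm ?A S" using r(1) by (simp only: norm_of_real abs_of_nonneg)
  also have "\<dots> \<le> ?r * (real n + \<delta> / 2)" by (rule mult_left_mono[OF nS r(1)])
  also have "\<dots> = real n" using pos by simp
  finally have 1: "poly_op G (gs @ es) ?q \<in> op_ball ?A n"
    unfolding eq using poly_op_bounded[OF G ges q] by (simp add: op_ball_def)
  have "op_dist ?A S (op_scale ?A (of_real ?r) S) = op_norm ?A (op_scale ?A (of_real (1 - ?r)) S)"
    by (intro arg_cong[where f="op_norm ?A"] ext) (simp add: op_diff_def op_scale_def left_diff_distrib)
  also have "\<dots> \<le> cmod (of_real (1 - ?r)) * op_norm ?A S" by (rule op_norm_scale_le[OF Sb])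
  also have "\<dots> = (1 - ?r) * op_norm ?A S"
    using r(2) by (simp only: norm_of_real abs_of_nonneg diff_ge_0_iff_ge)
  also have "\<dots> \<le> (1 - ?r) * (real n + \<delta> / 2)" using nS r(2) by (intro mult_left_mono) auto
  also have "\<dots> = \<delta> / 2" using pos by (simp add: left_diff_distrib)
  finally have "op_dist ?A S (op_scale ?A (of_real ?r) S) \<le> \<delta> / 2" .
  then have 2: "op_dist ?A T (poly_op G (gs @ es) ?q) \<le> \<delta>"
    using op_dist_triangle[OF Tb Sb op_scale_bounded[OF Sb, of "of_real ?r"]] dS eq by simp
  show ?thesis by (rule that[OF es q 1 2])
qed

abbreviation poly_ops :: "('g, 'm) monoid_scheme \<Rightarrow> 'g list \<Rightarrow> word_poly list \<Rightarrow> 'g operator list" where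
  "poly_ops G gs qs \<equiv> map (poly_op G gs) qs"

lemma poly_ops_append:
  "list_all (wf_poly (length gs)) qs \<Longrightarrow> poly_ops G (gs @ es) qs = poly_ops G gs qs"
  by (auto simp: list_all_iff poly_op_append)

lemma tuples_reduced_cstar_struct:
  "tuples (reduced_cstar_struct G) \<tau> =
     {as. list_all2 (\<lambda>T n. T \<in> reduced_cstar G \<and> op_norm (carrier G) T \<le> real n) as \<tau>}"
  by (simp add: tuples_def reduced_cstar_struct_def)

text \<open>
  The approximants of the entries of a tuple can be evaluated at one common extension of \<open>gs\<close>.
\<close>

lemma tuples_approx:
  assumes G: "group G" and "gs \<in> lists (carrier G)"
    and "cs \<in> tuples (reduced_cstar_struct G) \<tau>" and "\<tau> \<in> lists {n. 1 \<le> n}" and \<delta>: "\<delta> > 0"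
  shows "\<exists>es rs. es \<in> lists (carrier G) \<and> length rs = length \<tau> \<and>
    list_all (wf_poly (length (gs @ es))) rs \<and> op_tuple (carrier G) \<tau> (poly_ops G (gs @ es) rs) \<and>
    list_all2 (\<lambda>S T. op_dist (carrier G) S T \<le> \<delta>) cs (poly_ops G (gs @ es) rs)"
  using assms(2-4)
proof (induction \<tau> arbitrary: cs gs)
  case Nil
  then show ?case by (intro exI[of _ "[]"]) (simp add: tuples_reduced_cstar_struct)
next
  case (Cons n \<tau>)
  let ?A = "carrier G"
  obtain T cs' where cs: "cs = T # cs'" and T: "T \<in> reduced_cstar G" "op_norm ?A T \<le> real n"
    and cs': "cs' \<in> tuples (reduced_cstar_struct G) \<tau>"
    using Cons.prems(2) by (auto simp: tuples_reduced_cstar_struct list_all2_Cons2)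
  have n: "1 \<le> n" and \<tau>: "\<tau> \<in> lists {n. 1 \<le> n}" using Cons.prems(3) by auto
  obtain es q where es: "es \<in> lists ?A" and q: "wf_poly (length (gs @ es)) q"
    and ball: "poly_op G (gs @ es) q \<in> op_ball ?A n"
    and dist: "op_dist ?A T (poly_op G (gs @ es) q) \<le> \<delta>"
    by (rule reduced_cstar_approx[OF G Cons.prems(1) T n \<delta>])
  have ges: "gs @ es \<in> lists ?A" using Cons.prems(1) es by simp
  obtain es' rs where es': "es' \<in> lists ?A" "length rs = length \<tau>"
    "list_all (wf_poly (length ((gs @ es) @ es'))) rs"
    "op_tuple ?A \<tau> (poly_ops G ((gs @ es) @ es') rs)"
    "list_all2 (\<lambda>S T. op_dist ?A S T \<le> \<delta>) cs' (poly_ops G ((gs @ es) @ es') rs)"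
    using Cons.IH[OF ges cs' \<tau>] by blast
  have q': "wf_poly (length (gs @ es @ es')) q"
    by (rule wf_poly_mono[OF q]) simp
  have "poly_op G (gs @ es @ es') q = poly_op G (gs @ es) q"
    using poly_op_append[OF q, of G es'] by simp
  then show ?case
    using es es' q' ball dist cs by (intro exI[of _ "es @ es'"] exI[of _ "q # rs"]) simp
qed


section \<open>Weak moduli\<close>

lemma
  assumes "weak_modulus \<Omega>"
  shows weak_modulus_zero: "\<Omega> (\<lambda>_. 0) = 0"
    and weak_modulus_mono:
      "\<delta> \<in> nonneg_seqs \<Longrightarrow> \<delta>' \<in> nonneg_seqs \<Longrightarrow> (\<And>i. \<delta> i \<le> \<delta>' i) \<Longrightarrow> \<Omega> \<delta> \<le> \<Omega> \<delta>'"
    and weak_modulus_subadd: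
      "\<delta> \<in> nonneg_seqs \<Longrightarrow> \<delta>' \<in> nonneg_seqs \<Longrightarrow> \<Omega> (\<lambda>i. \<delta> i + \<delta>' i) \<le> \<Omega> \<delta> + \<Omega> \<delta>'"
    and weak_modulus_cont: "\<delta> \<in> nonneg_seqs \<Longrightarrow> continuous_on {0..} (\<lambda>t. \<Omega> (\<delta>(i := t)))"
  using assms unfolding weak_modulus_def by blast+

lemma weak_modulus_finite_support_le:
  assumes \<Omega>: "weak_modulus \<Omega>" and "finite I" and "t \<ge> 0"
  shows "\<Omega> (\<lambda>i. if i \<in> I then t else 0) \<le> (\<Sum>i\<in>I. \<Omega> ((\<lambda>_. 0)(i := t)))"
  using \<open>finite I\<close>
proof (induction I rule: finite_induct)
  case empty
  then show ?case using weak_modulus_zero[OF \<Omega>] by simp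
next
  case (insert i I)
  let ?s = "(\<lambda>_. 0)(i := t)" and ?u = "\<lambda>j. if j \<in> I then t else 0"
  have "(\<lambda>j. if j \<in> insert i I then t else 0) = (\<lambda>j. ?s j + ?u j)"
    using insert.hyps by auto
  moreover have "\<Omega> (\<lambda>j. ?s j + ?u j) \<le> \<Omega> ?s + \<Omega> ?u"
    by (rule weak_modulus_subadd[OF \<Omega>]) (use \<open>t \<ge> 0\<close> in \<open>auto simp: nonneg_seqs_def\<close>)
  ultimately have "\<Omega> (\<lambda>j. if j \<in> insert i I then t else 0) \<le> \<Omega> ?s + \<Omega> ?u" by simp
  also have "\<dots> \<le> \<Omega> ?s + (\<Sum>i\<in>I. \<Omega> ((\<lambda>_. 0)(i := t)))"
    by (rule add_left_mono[OF insert.IH])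
  finally show ?case by (simp only: sum.insert[OF insert.hyps])
qed

text \<open>
  Continuity in each argument and subadditivity make \<open>\<Omega>\<close> continuous at zero in finitely many
  arguments jointly.
\<close>

lemma weak_modulus_small:
  assumes \<Omega>: "weak_modulus \<Omega>" and I: "finite I" and "0 < (\<epsilon>::ennreal)"
  obtains t where "t > 0" "\<Omega> (\<lambda>i. if i \<in> I then t else 0) \<le> \<epsilon>"
proof -
  have "((\<lambda>t. \<Omega> ((\<lambda>_. 0)(i := t))) \<longlongrightarrow> 0) (at 0 within {0..})" for i
  proof -
    have "continuous_on {0..} (\<lambda>t. \<Omega> ((\<lambda>_. 0)(i := t)))"
      by (rule weak_modulus_cont[OF \<Omega>]) (simp add: nonneg_seqs_def)
    then have "((\<lambda>t. \<Omega> ((\<lambda>_. 0)(i := t))) \<longlongrightarrow> \<Omega> ((\<lambda>_. 0)(i := 0))) (at 0 within {0..})"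
      unfolding continuous_on_def by (metis atLeast_iff order_refl)
    moreover have "(\<lambda>_. 0)(i := 0) = (\<lambda>_. 0::real)" by auto
    ultimately show ?thesis using weak_modulus_zero[OF \<Omega>] by simp
  qed
  then have "((\<lambda>t. \<Sum>i\<in>I. \<Omega> ((\<lambda>_. 0)(i := t))) \<longlongrightarrow> (\<Sum>i\<in>I. 0)) (at 0 within {0..})"
    by (intro tendsto_sum)
  then have "\<forall>\<^sub>F t in at 0 within {0..}. (\<Sum>i\<in>I. \<Omega> ((\<lambda>_. 0)(i := t))) < \<epsilon>"
    using \<open>0 < \<epsilon>\<close> by (intro order_tendstoD) auto
  then obtain d where d: "d > 0"
    "\<forall>t\<in>{0..}. t \<noteq> 0 \<and> dist t 0 < d \<longrightarrow> (\<Sum>i\<in>I. \<Omega> ((\<lambda>_. 0)(i := t))) < \<epsilon>"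
    unfolding eventually_at by auto
  then have "(\<Sum>i\<in>I. \<Omega> ((\<lambda>_. 0)(i := d / 2))) < \<epsilon>" by auto
  moreover have "\<Omega> (\<lambda>i. if i \<in> I then d / 2 else 0) \<le> (\<Sum>i\<in>I. \<Omega> ((\<lambda>_. 0)(i := d / 2)))"
    using d(1) by (intro weak_modulus_finite_support_le[OF \<Omega> I]) simp
  ultimately show ?thesis using that[of "d / 2"] d(1) by simp
qed

lemma weak_modulus_append_le:
  assumes \<Omega>: "weak_modulus \<Omega>" and as: "op_tuple A \<sigma> as" "op_tuple A \<sigma> as'"
    and cs: "list_all2 (\<lambda>S T. op_dist A S T \<le> t) cs cs'"
    and cs': "op_tuple A \<tau> cs" "op_tuple A \<tau> cs'" and "t \<ge> 0"
  shows "\<Omega> (op_dists A (as @ cs) (as' @ cs'))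
    \<le> \<Omega> (op_dists A as as')
      + \<Omega> (\<lambda>i. if i \<in> {length as..<length as + length cs} then t else 0)"
proof -
  let ?D = "op_dists A as as'"
  let ?E = "\<lambda>i. if i \<in> {length as..<length as + length cs} then t else 0"
  have len: "length as' = length as" "length cs' = length cs"
    using as cs by (auto dest!: list_all2_lengthD)
  have D: "?D \<in> nonneg_seqs" by (rule op_dists_nonneg[OF as])
  have E: "?E \<in> nonneg_seqs" using \<open>t \<ge> 0\<close> by (simp add: nonneg_seqs_def)
  have "op_tuple A (\<sigma> @ \<tau>) (as @ cs)" "op_tuple A (\<sigma> @ \<tau>) (as' @ cs')"
    using as cs' by (auto intro: list_all2_appendI)
  then have "op_dists A (as @ cs) (as' @ cs') \<in> nonneg_seqs" by (rule op_dists_nonneg)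
  moreover have "(\<lambda>i. ?D i + ?E i) \<in> nonneg_seqs" using D E by (auto simp: nonneg_seqs_def)
  moreover have "op_dists A (as @ cs) (as' @ cs') i \<le> ?D i + ?E i" for i
    using cs by (auto simp: op_dists_def nth_append len list_all2_conv_all_nth)
  ultimately have "\<Omega> (op_dists A (as @ cs) (as' @ cs')) \<le> \<Omega> (\<lambda>i. ?D i + ?E i)"
    by (rule weak_modulus_mono[OF \<Omega>])
  also have "\<dots> \<le> \<Omega> ?D + \<Omega> ?E" by (rule weak_modulus_subadd[OF \<Omega> D E])
  finally show ?thesis .
qed


section \<open>Transfer of back-and-forth systems\<close>

text \<open>
  The least element \<open>None\<close> of the order \<open>1 + \<alpha>\<close> is zero, and back-and-forth equivalence at zero includes the
  agreement on equations.
\<close>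

lemma same_equationsI:
  assumes "bf_equiv group_language (group_struct G) (group_struct H) (None :: 'o::wellorder option) gs hs"
    and "length gs = length hs"
  shows "same_equations G gs H hs"
proof -
  have "is_zero (None :: 'o option)" by (auto simp: is_zero_def)
  then have qf: "qf_sat (group_struct G) gs \<phi> \<longleftrightarrow> qf_sat (group_struct H) hs \<phi>"
    if "wf_qf group_language (length gs) \<phi>" for \<phi>
    using assms(1) that by (subst (asm) bf_equiv.simps) simp
  show ?thesis
    unfolding same_equations_def
    using assms(2) qf[of "Equal s t" for s t] by (simp add: group_struct_def)
qed

lemma bf_equiv_Some_iff:
  fixes \<alpha> :: "'o::wellorder"
  shows "bf_equiv L M N (Some \<alpha>) as bs \<longleftrightarrow>
    (\<forall>\<beta>\<in>insert None (Some ` {..<\<alpha>}).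
       (\<forall>cs\<in>lists (universe M). \<exists>ds\<in>{ds \<in> lists (universe N). length ds = length cs}.
          bf_equiv L M N \<beta> (as @ cs) (bs @ ds)) \<and>
       (\<forall>ds\<in>lists (universe N). \<exists>cs\<in>{cs \<in> lists (universe M). length cs = length ds}.
          bf_equiv L M N \<beta> (as @ cs) (bs @ ds)))"
proof -
  have pred: "{..<Some \<alpha>} = insert None (Some ` {..<\<alpha>})"
    using lessThan_one_plus[of \<alpha>] by (simp add: one_plus_def)
  then have "\<not> is_zero (Some \<alpha>)" by (simp add: is_zero_def)
  then show ?thesis unfolding bf_equiv.simps[of L M N "Some \<alpha>"] pred by (simp add: ball_conj_distrib)
qed

text \<open>
  This is where the summand 1 of \<open>1 + \<alpha>\<close> is spent: an extension by a finite tuple, at level zero, is needed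
  to compare operator norms.
\<close>

lemma poly_op_norm_eq:
  fixes \<alpha> :: "'o::wellorder"
  assumes G: "group G" "gs \<in> lists (carrier G)" and H: "group H" "hs \<in> lists (carrier H)"
    and len: "length gs = length hs"
    and bf: "bf_equiv group_language (group_struct G) (group_struct H) (Some \<alpha>) gs hs"
    and q: "wf_poly (length gs) q"
  shows "op_norm (carrier G) (poly_op G gs q) = op_norm (carrier H) (poly_op H hs q)"
proof (rule antisym)
  let ?bf = "bf_equiv group_language (group_struct G) (group_struct H) (None :: 'o option)"
  have univ: "universe (group_struct G) = carrier G" "universe (group_struct H) = carrier H"
    by (simp_all add: group_struct_def)
  show "op_norm (carrier G) (poly_op G gs q) \<le> op_norm (carrier H) (poly_op H hs q)"
  proof (rule poly_op_norm_le[OF G H len _ q])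
    fix cs assume "cs \<in> lists (carrier G)"
    then obtain ds where "ds \<in> lists (carrier H)" "length ds = length cs" "?bf (gs @ cs) (hs @ ds)"
      using bf unfolding bf_equiv_Some_iff univ by blast
    then show "\<exists>ds\<in>lists (carrier H). length ds = length cs \<and> same_equations G (gs @ cs) H (hs @ ds)"
      using len by (intro bexI[of _ ds]) (auto intro: same_equationsI)
  qed
  show "op_norm (carrier H) (poly_op H hs q) \<le> op_norm (carrier G) (poly_op G gs q)"
  proof (rule poly_op_norm_le[OF H G len[symmetric]])
    fix ds assume "ds \<in> lists (carrier H)"
    then obtain cs where "cs \<in> lists (carrier G)" "length cs = length ds" "?bf (gs @ cs) (hs @ ds)"
      using bf unfolding bf_equiv_Some_iff univ by blast
    then show "\<exists>cs\<in>lists (carrier G). length cs = length ds \<and> same_equations H (hs @ ds) G (gs @ cs)"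
      using len by (intro bexI[of _ cs]) (auto intro: same_equations_commute[OF same_equationsI])
  qed (use q len in simp)
qed

lemma poly_op_diff:
  assumes "group G" "gs \<in> lists (carrier G)" "wf_poly (length gs) p" "wf_poly (length gs) q"
  shows "op_diff (carrier G) (poly_op G gs p) (poly_op G gs q)
    = poly_op G gs (poly_fun (CAdd 1 1) [p, poly_fun (CScale (-1) 1) [q]])"
proof -
  note s = operator_fun_poly_op[OF assms(1,2), of "CScale (-1) 1" "[q]"]
  have "wf_poly (length gs) (poly_fun (CScale (-1) 1) [q])" using s(1) assms(4) by simp
  then show ?thesis
    using operator_fun_poly_op(2)[OF assms(1,2), of "CAdd 1 1" "[p, poly_fun (CScale (-1) 1) [q]]"]
      s(2) assms(3,4) op_diff_eq_add_scale[of _ "poly_op G gs p" "poly_op G gs q"] by simp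
qed

text \<open>
  The only predicate is the distance, and the distance of two combinations is the norm of a third.
\<close>

lemma basic_val_poly_ops_eq:
  assumes G: "group G" "gs \<in> lists (carrier G)" and H: "group H" "hs \<in> lists (carrier H)"
    and len: "length gs = length hs"
    and norm_eq: "\<And>q. wf_poly (length gs) q \<Longrightarrow>
      op_norm (carrier G) (poly_op G gs q) = op_norm (carrier H) (poly_op H hs q)"
    and qs: "length qs = length \<sigma>" "list_all (wf_poly (length gs)) qs"
    and \<psi>: "wf_basic cstar_language \<sigma> \<psi>"
  shows "basic_val (reduced_cstar_struct G) (poly_ops G gs qs) \<psi>
    = basic_val (reduced_cstar_struct H) (poly_ops H hs qs) \<psi>"
proof -
  have qsH: "list_all (wf_poly (length hs)) qs" using qs len by simp
  have atom: "atomic_val (reduced_cstar_struct G) (poly_ops G gs qs) \<phi>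
    = atomic_val (reduced_cstar_struct H) (poly_ops H hs qs) \<phi>"
    if wf: "wf_atomic cstar_language \<sigma> \<phi>" for \<phi>
  proof -
    obtain n s t where \<phi>: "\<phi> = Atom (CDist n) [s, t]"
      and s: "has_sort cstar_language \<sigma> s n" and t: "has_sort cstar_language \<sigma> t n"
      using wf by (cases \<phi>) (auto simp: wf_atomic_def list_all2_Cons2)
    let ?p = "trm_val poly_fun qs s" and ?q = "trm_val poly_fun qs t"
    let ?d = "poly_fun (CAdd 1 1) [?p, poly_fun (CScale (-1) 1) [?q]]"
    note sG = trm_val_poly_op[OF G s qs] and tG = trm_val_poly_op[OF G t qs]
    note sH = trm_val_poly_op[OF H s qs(1) qsH] and tH = trm_val_poly_op[OF H t qs(1) qsH]
    have d: "wf_poly (length gs) ?d" using sG tG by (auto simp: wf_poly_def)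
    have "atomic_val (reduced_cstar_struct G) (poly_ops G gs qs) \<phi>
        = op_norm (carrier G) (poly_op G gs ?d)"
      using sG tG poly_op_diff[OF G] by (simp add: atomic_val_def \<phi> reduced_cstar_struct_def)
    moreover have "atomic_val (reduced_cstar_struct H) (poly_ops H hs qs) \<phi>
        = op_norm (carrier H) (poly_op H hs ?d)"
      using sH tH poly_op_diff[OF H] by (simp add: atomic_val_def \<phi> reduced_cstar_struct_def)
    ultimately show ?thesis using norm_eq[OF d] by simp
  qed
  show ?thesis
    unfolding basic_val_def
    by (rule arg_cong[where f="connective \<psi>"], rule restrict_ext, rule atom)
       (use \<psi> in \<open>auto simp: wf_basic_def list_all_length\<close>)
qed

text \<open>
  One direction of the induction step, isolated because it is used with \<open>G\<close> and \<open>H\<close> in both orders.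
  For a smaller ordinal \<open>\<beta>\<close>, the relation \<open>E\<close> is equivalence at level \<open>1 + \<beta>\<close> and \<open>f ds\<close> is the
  pseudo-distance \<open>r\<^sub>\<beta>\<close> of the tuples extended by \<open>cs\<close> and \<open>ds\<close>.  The tuple \<open>cs\<close> is replaced by combinations
  of words at some \<open>es\<close>, and \<open>ds\<close> consists of the same combinations at a matching \<open>fs\<close>.  The entries
  of \<open>ds\<close> belong to the right balls since the norms agree.
\<close>

lemma forth_step:
  fixes G :: "('g, 'm) monoid_scheme" and H :: "('h, 'k) monoid_scheme"
    and f :: "'h operator list \<Rightarrow> ennreal"
  assumes G: "group G" "gs \<in> lists (carrier G)" and H: "group H" "hs \<in> lists (carrier H)"
    and \<Omega>: "weak_modulus \<Omega>" and \<tau>: "\<tau> \<in> lists {n. 1 \<le> n}"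
    and len: "length gs = length hs"
    and qs: "list_all (wf_poly (length gs)) qs"
    and as: "op_tuple (carrier G) \<sigma> as" "op_tuple (carrier G) \<sigma> (poly_ops G gs qs)"
    and bs: "op_tuple (carrier H) \<sigma> bs" "op_tuple (carrier H) \<sigma> (poly_ops H hs qs)"
    and cs: "cs \<in> tuples (reduced_cstar_struct G) \<tau>"
    and forth: "\<And>es. es \<in> lists (carrier G) \<Longrightarrow>
      \<exists>fs\<in>lists (carrier H). length fs = length es \<and> E (gs @ es) (hs @ fs)"
    and norm_eq: "\<And>es fs q. es \<in> lists (carrier G) \<Longrightarrow> fs \<in> lists (carrier H) \<Longrightarrow>
      length fs = length es \<Longrightarrow> E (gs @ es) (hs @ fs) \<Longrightarrow> wf_poly (length (gs @ es)) q \<Longrightarrow>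
      op_norm (carrier G) (poly_op G (gs @ es) q) = op_norm (carrier H) (poly_op H (hs @ fs) q)"
    and f: "\<And>es fs rs ds. es \<in> lists (carrier G) \<Longrightarrow> fs \<in> lists (carrier H) \<Longrightarrow>
      length fs = length es \<Longrightarrow> E (gs @ es) (hs @ fs) \<Longrightarrow>
      length rs = length \<tau> \<Longrightarrow> list_all (wf_poly (length (gs @ es))) rs \<Longrightarrow>
      op_tuple (carrier G) \<tau> (poly_ops G (gs @ es) rs) \<Longrightarrow>
      op_tuple (carrier H) \<tau> (poly_ops H (hs @ fs) rs) \<Longrightarrow> op_tuple (carrier G) \<tau> cs \<Longrightarrow>
      op_tuple (carrier H) \<tau> ds \<Longrightarrow>
      f ds \<le> \<Omega> (op_dists (carrier G) (as @ cs) (poly_ops G (gs @ es) (qs @ rs)))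
        + \<Omega> (op_dists (carrier H) (bs @ ds) (poly_ops H (hs @ fs) (qs @ rs)))"
  shows "(INF ds\<in>tuples (reduced_cstar_struct H) \<tau>. f ds)
    \<le> \<Omega> (op_dists (carrier G) as (poly_ops G gs qs)) + \<Omega> (op_dists (carrier H) bs (poly_ops H hs qs))"
    (is "?L \<le> ?a + ?b")
proof (rule ennreal_le_epsilon)
  fix \<epsilon> :: real assume \<epsilon>: "0 < \<epsilon>"
  let ?A = "carrier G" and ?B = "carrier H"
  have csb: "op_tuple ?A \<tau> cs"
    using cs by (auto simp: tuples_reduced_cstar_struct op_ball_def reduced_cstar_def elim: list_all2_mono)
  obtain t where t: "t > 0"
    "\<Omega> (\<lambda>i. if i \<in> {length as..<length as + length cs} then t else 0) \<le> ennreal \<epsilon>"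
    by (rule weak_modulus_small[OF \<Omega>, of "{length as..<length as + length cs}" "ennreal \<epsilon>"])
       (use \<epsilon> in auto)
  obtain es rs where es: "es \<in> lists ?A" and rs: "length rs = length \<tau>"
    and wfr: "list_all (wf_poly (length (gs @ es))) rs"
    and ballG: "op_tuple ?A \<tau> (poly_ops G (gs @ es) rs)"
    and close: "list_all2 (\<lambda>S T. op_dist ?A S T \<le> t) cs (poly_ops G (gs @ es) rs)"
    using tuples_approx[OF G cs \<tau> t(1)] by blast
  obtain fs where fs: "fs \<in> lists ?B" and lfs: "length fs = length es" and E: "E (gs @ es) (hs @ fs)"
    using forth[OF es] by blast
  have hfs: "hs @ fs \<in> lists ?B" using H(2) fs by simp
  have wfr': "list_all (wf_poly (length (hs @ fs))) rs" using wfr len lfs by simp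
  have qs': "list_all (wf_poly (length hs)) qs" using qs len by simp
  let ?ds = "poly_ops H (hs @ fs) rs"
  have ballH: "op_tuple ?B \<tau> ?ds"
    using ballG wfr norm_eq[OF es fs lfs E] poly_op_bounded[OF H(1) hfs] wfr'
    by (auto simp: list_all2_conv_all_nth list_all_length op_ball_def)
  have ds: "?ds \<in> tuples (reduced_cstar_struct H) \<tau>"
    using ballH wfr' poly_op_in_reduced_cstar[OF H(1) hfs]
    by (auto simp: tuples_reduced_cstar_struct list_all2_conv_all_nth list_all_length op_ball_def)
  have self: "list_all2 (\<lambda>S T. op_dist ?B S T \<le> 0) ?ds ?ds"
    using op_norm_diff_self[OF poly_op_bounded[OF H(1) hfs]] wfr'
    by (auto simp: list_all2_conv_all_nth list_all_length)
  have "?L \<le> f ?ds" by (rule INF_lower[OF ds])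
  also have "\<dots> \<le> \<Omega> (op_dists ?A (as @ cs) (poly_ops G (gs @ es) (qs @ rs)))
        + \<Omega> (op_dists ?B (bs @ ?ds) (poly_ops H (hs @ fs) (qs @ rs)))"
    by (rule f[OF es fs lfs E rs wfr ballG ballH csb ballH])
  also have "\<Omega> (op_dists ?A (as @ cs) (poly_ops G (gs @ es) (qs @ rs))) \<le> ?a + ennreal \<epsilon>"
    using weak_modulus_append_le[OF \<Omega> as close csb ballG] t
    by (auto simp: poly_ops_append[OF qs] intro: order_trans add_left_mono)
  also have "\<Omega> (op_dists ?B (bs @ ?ds) (poly_ops H (hs @ fs) (qs @ rs))) \<le> ?b"
    using weak_modulus_append_le[OF \<Omega> bs self ballH ballH]
    by (simp add: poly_ops_append[OF qs'] weak_modulus_zero[OF \<Omega>] cong: if_cong)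
  finally show "?L \<le> ?a + ?b + ennreal \<epsilon>" by (simp add: add_ac add_mono)
qed

text \<open>
  The statement proved by induction.  Allowing arbitrary tuples \<open>as\<close> and \<open>bs\<close>, with an error measured
  by \<open>\<Omega>\<close>, makes a separate proof of the \<open>\<Omega>\<close>-continuity of the pseudo-distances superfluous.
\<close>

proposition bf_dist_le:
  fixes \<alpha> :: "'o::wellorder"
    and G :: "('g, 'm) monoid_scheme" and H :: "('h, 'k) monoid_scheme"
  assumes G: "group G" and H: "group H" and \<Omega>: "weak_modulus \<Omega>"
    and "gs \<in> lists (carrier G)" "hs \<in> lists (carrier H)" "length gs = length hs"
    and "bf_equiv group_language (group_struct G) (group_struct H) (Some \<alpha>) gs hs"
    and "length qs = length \<sigma>" "list_all (wf_poly (length gs)) qs"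
    and "op_tuple (carrier G) \<sigma> as" "op_tuple (carrier G) \<sigma> (poly_ops G gs qs)"
    and "op_tuple (carrier H) \<sigma> bs" "op_tuple (carrier H) \<sigma> (poly_ops H hs qs)"
  shows "bf_dist cstar_language \<Omega> (reduced_cstar_struct G) (reduced_cstar_struct H) \<alpha> \<sigma> as bs
    \<le> \<Omega> (op_dists (carrier G) as (poly_ops G gs qs)) + \<Omega> (op_dists (carrier H) bs (poly_ops H hs qs))"
  using assms(4-)
proof (induction \<alpha> arbitrary: gs hs qs \<sigma> as bs rule: less_induct)
  case (less \<alpha>)
  let ?A = "carrier G" and ?B = "carrier H"
  let ?M = "reduced_cstar_struct G" and ?N = "reduced_cstar_struct H"
  let ?bf = "bf_equiv group_language (group_struct G) (group_struct H)"
  let ?r = "bf_dist cstar_language \<Omega> ?M ?N"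
  let ?a = "\<Omega> (op_dists ?A as (poly_ops G gs qs))" and ?b = "\<Omega> (op_dists ?B bs (poly_ops H hs qs))"
  note gs = less.prems(1) and hs = less.prems(2) and len = less.prems(3) and bf = less.prems(4)
    and lq = less.prems(5) and qs = less.prems(6) and as = less.prems(7,8) and bs = less.prems(9,10)
  have univ: "universe (group_struct G) = ?A" "universe (group_struct H) = ?B"
    by (simp_all add: group_struct_def)
  show ?case
  proof (cases "is_zero \<alpha>")
    case True
    have "ennreal \<bar>basic_val ?M as \<psi> - basic_val ?N bs \<psi>\<bar> \<le> ?a + ?b"
      if \<psi>: "\<psi> \<in> basic_Omega_formulas cstar_language \<Omega> \<sigma>" for \<psi>
    proof -
      have eq: "basic_val ?M (poly_ops G gs qs) \<psi> = basic_val ?N (poly_ops H hs qs) \<psi>"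
        using \<psi> by (intro basic_val_poly_ops_eq[OF G gs H hs len _ lq qs]
            poly_op_norm_eq[OF G gs H hs len bf]) (auto simp: basic_Omega_formulas_def)
      have "\<bar>basic_val ?M as \<psi> - basic_val ?N bs \<psi>\<bar>
        \<le> \<bar>basic_val ?M as \<psi> - basic_val ?M (poly_ops G gs qs) \<psi>\<bar>
          + \<bar>basic_val ?N bs \<psi> - basic_val ?N (poly_ops H hs qs) \<psi>\<bar>" using eq by linarith
      then have "ennreal \<bar>basic_val ?M as \<psi> - basic_val ?N bs \<psi>\<bar>
        \<le> ennreal \<bar>basic_val ?M as \<psi> - basic_val ?M (poly_ops G gs qs) \<psi>\<bar>
          + ennreal \<bar>basic_val ?N bs \<psi> - basic_val ?N (poly_ops H hs qs) \<psi>\<bar>"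
        by (simp add: ennreal_plus[symmetric] del: ennreal_plus)
      also have "\<dots> \<le> ?a + ?b" by (intro add_mono basic_val_modulus[OF \<psi>] as bs)
      finally show ?thesis .
    qed
    then show ?thesis using True by (subst bf_dist.simps) (auto intro: SUP_least)
  next
    case False
    note bf_ext = bf[unfolded bf_equiv_Some_iff univ]
    have IH: "?r \<beta> (\<sigma> @ \<tau>) (as @ cs) (bs @ ds)
        \<le> \<Omega> (op_dists ?A (as @ cs) (poly_ops G (gs @ es) (qs @ rs)))
          + \<Omega> (op_dists ?B (bs @ ds) (poly_ops H (hs @ fs) (qs @ rs)))"
      if "\<beta> < \<alpha>" "es \<in> lists ?A" "fs \<in> lists ?B" "length fs = length es"
        "?bf (Some \<beta>) (gs @ es) (hs @ fs)" "length rs = length \<tau>"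
        "list_all (wf_poly (length (gs @ es))) rs" "op_tuple ?A \<tau> (poly_ops G (gs @ es) rs)"
        "op_tuple ?B \<tau> (poly_ops H (hs @ fs) rs)" "op_tuple ?A \<tau> cs" "op_tuple ?B \<tau> ds"
      for \<beta> \<tau> es fs rs cs ds
    proof (rule less.IH[OF that(1)])
      have "list_all (wf_poly (length (gs @ es))) qs"
        using qs by (auto simp: list_all_iff intro: wf_poly_mono)
      then show "list_all (wf_poly (length (gs @ es))) (qs @ rs)" using that(7) by simp
      have "list_all (wf_poly (length hs)) qs" using qs len by simp
      then show "op_tuple ?B (\<sigma> @ \<tau>) (poly_ops H (hs @ fs) (qs @ rs))"
        using bs(2) that(9) by (simp add: poly_ops_append list_all2_appendI)
      show "op_tuple ?A (\<sigma> @ \<tau>) (poly_ops G (gs @ es) (qs @ rs))"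
        using as(2) that(8) by (simp add: poly_ops_append[OF qs] list_all2_appendI)
    qed (use that gs hs len lq as(1) bs(1) in \<open>auto intro: list_all2_appendI\<close>)
    have norm_eq: "op_norm ?A (poly_op G (gs @ es) q) = op_norm ?B (poly_op H (hs @ fs) q)"
      if "es \<in> lists ?A" "fs \<in> lists ?B" "length fs = length es"
        "?bf (Some \<beta>) (gs @ es) (hs @ fs)" "wf_poly (length (gs @ es)) q" for es fs q and \<beta> :: 'o
      by (rule poly_op_norm_eq[OF G _ H _ _ that(4,5)]) (use that gs hs len in auto)
    have forth_bound: "(INF ds\<in>tuples ?N \<tau>. ?r \<beta> (\<sigma> @ \<tau>) (as @ cs) (bs @ ds)) \<le> ?a + ?b"
      if \<beta>: "\<beta> < \<alpha>" and \<tau>: "\<tau> \<in> lists {n. 1 \<le> n}" and cs: "cs \<in> tuples ?M \<tau>" for \<beta> \<tau> cs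
    proof (rule forth_step[OF G gs H hs \<Omega> \<tau> len qs as bs cs, where E = "?bf (Some \<beta>)"])
      show "\<exists>fs\<in>lists ?B. length fs = length es \<and> ?bf (Some \<beta>) (gs @ es) (hs @ fs)"
        if "es \<in> lists ?A" for es
        using bf_ext that \<beta> by blast
    qed (assumption | rule norm_eq IH[OF \<beta>])+
    have back_bound: "(INF cs\<in>tuples ?M \<tau>. ?r \<beta> (\<sigma> @ \<tau>) (as @ cs) (bs @ ds)) \<le> ?b + ?a"
      if \<beta>: "\<beta> < \<alpha>" and \<tau>: "\<tau> \<in> lists {n. 1 \<le> n}" and ds: "ds \<in> tuples ?N \<tau>" for \<beta> \<tau> ds
    proof (rule forth_step[OF H hs G gs \<Omega> \<tau> len[symmetric] qs[unfolded len] bs as ds,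
          where E = "\<lambda>hs gs. ?bf (Some \<beta>) gs hs"])
      show "\<exists>es\<in>lists ?A. length es = length fs \<and> ?bf (Some \<beta>) (gs @ es) (hs @ fs)"
        if "fs \<in> lists ?B" for fs
        using bf_ext that \<beta> by blast
    next
      fix fs es q
      assume "fs \<in> lists ?B" "es \<in> lists ?A" "length es = length fs"
        "?bf (Some \<beta>) (gs @ es) (hs @ fs)" "wf_poly (length (hs @ fs)) q"
      then show "op_norm ?B (poly_op H (hs @ fs) q) = op_norm ?A (poly_op G (gs @ es) q)"
        using norm_eq[of es fs \<beta> q] len by simp
    next
      fix fs es rs cs
      assume "fs \<in> lists ?B" "es \<in> lists ?A" "length es = length fs"
        "?bf (Some \<beta>) (gs @ es) (hs @ fs)" "length rs = length \<tau>"
        "list_all (wf_poly (length (hs @ fs))) rs" "op_tuple ?B \<tau> (poly_ops H (hs @ fs) rs)"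
        "op_tuple ?A \<tau> (poly_ops G (gs @ es) rs)" "op_tuple ?B \<tau> ds" "op_tuple ?A \<tau> cs"
      then show "?r \<beta> (\<sigma> @ \<tau>) (as @ cs) (bs @ ds)
        \<le> \<Omega> (op_dists ?B (bs @ ds) (poly_ops H (hs @ fs) (qs @ rs)))
          + \<Omega> (op_dists ?A (as @ cs) (poly_ops G (gs @ es) (qs @ rs)))"
        using IH[OF \<beta>, of es fs rs \<tau> cs ds] len by (simp add: add.commute)
    qed
    show ?thesis
      unfolding bf_dist.simps[of _ _ _ _ \<alpha>] if_not_P[OF False]
      by (intro max.boundedI SUP_least forth_bound order_trans[OF back_bound])
         (auto simp: add.commute)
  qed
qed

theorem theorem4p4:
  fixes \<alpha> :: "'o::wellorder"
    and G :: "('g, 'm) monoid_scheme"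
    and H :: "('h, 'k) monoid_scheme"
    and \<Omega> :: "(nat \<Rightarrow> real) \<Rightarrow> ennreal"
  assumes "group G" and "group H"
    and "bf_equiv_struct group_language (one_plus \<alpha>) (group_struct G) (group_struct H)"
    and "weak_modulus \<Omega>"
  shows "metric_bf_equiv_struct cstar_language \<Omega> \<alpha>
           (reduced_cstar_struct G) (reduced_cstar_struct H)"
proof -
  have "bf_equiv group_language (group_struct G) (group_struct H) (Some \<alpha>) [] []"
    using assms(3) by (simp add: bf_equiv_struct_def one_plus_def)
  then have "bf_dist cstar_language \<Omega> (reduced_cstar_struct G) (reduced_cstar_struct H) \<alpha> [] [] []
      \<le> \<Omega> (op_dists (carrier G) [] []) + \<Omega> (op_dists (carrier H) [] [])"
    using bf_dist_le[OF assms(1,2,4), of "[]" "[]" \<alpha> "[]" "[]" "[]" "[]"] by simp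
  also have "\<dots> = 0" by (simp add: op_dists_def weak_modulus_zero[OF assms(4)])
  finally show ?thesis by (simp add: metric_bf_equiv_struct_def)
qed

end
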